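(* Suppose the total batch size $S$ follows a negative binomial distribution with probability generating function $$G(z):=\mathbb{E}[z^S]=\frac{1}{[1+\nu(1-z)]^r},$$ with each customer independently assigned entry queue $j$ with probability $p_j$. Let $t\ge0$, $v\in\{2,\dots,J\}$, and let $n_1,\dots,n_v$ be non-negative integers with $n_v\ge1$. Then $$P\big[\mathbf{N}(t)=(n_1,\dots,n_v,0,\dots,0)\big]=\sum_{i_1=0}^{n_1}\cdots\sum_{i_{v-1}=0}^{n_{v-1}}\ \sum_{i_v=1}^{n_v}\Big[\frac{i_v}{n_v}\,P\big[\mathbf{N}(t)=(n_1-i_1,\dots,n_v-i_v,0,\dots,0)\big]$$ $$\cdot\int_0^t\lambda(\tau)\,\frac{\Gamma\big(r+\sum_{k=1}^v i_k\big)}{\Gamma(r)\prod_{k=1}^v i_k!}\ \frac{\nu^{\sum_{k=1}^v i_k}}{\big[1+\nu\sum_{k=1}^J q_k(t-\tau)\big]^{r+\sum_{k=1}^v i_k}}\ \prod_{k=1}^v q_k(t-\tau)^{i_k}\,d\tau\Big],$$ with the convention $0^0=1$.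
   Context: Consider an open network of $J$ infinite server queues, indexed $1,\dots,J$, empty at time $0$. Batches arrive at the points $T_1,T_2,\dots$ of a non-homogeneous Poisson process on $[0,\infty)$ with rate function $\lambda(t)\ge 0$ (measurable, with $\int_0^t\lambda(\tau)\,d\tau<\infty$ for all $t$). At time $T_i$, $\Sigma_{ij}$ customers arrive at queue $j$, for $j=1,\dots,J$. The vectors $\mathbf{\Sigma}_i=(\Sigma_{i1},\dots,\Sigma_{iJ})$ are i.i.d. (and independent of the arrival times), with the same distribution as a generic vector $\mathbf{S}=(S_1,\dots,S_J)$ with non-negative integer components. It is assumed that $\mathbb{E}\big[\prod_{j=1}^J z_j^{S_j}\big]=G_S\big(\sum_{j=1}^J p_jz_j\big)$, where $p_j\ge0$, $\sum_j p_j=1$, and $G_S(z)=\mathbb{E}[z^S]$ is the probability generating function of a univariate non-negative integer-valued random variable $S$ (the total batch size). The $\ell$th customer entering queue $j$ at time $T_i$ carries a stochastic process $X^j_{i,\ell}(t)$, $t\ge 0$, where $X^j_{i,\ell}(t)=k\in\{1,\dots,J\}$ means that the customer is in queue $k$ at time $T_i+t$ (and $X^j_{i,\ell}(t)\notin\{1,\dots,J\}$ if the customer has left the network). These processes are mutually independent and independent of the arrival times and batch sizes (conditionally on the node of entry), with $P(X^j_{i,\ell}(t)=k)=q^j_k(t)$ (measurable in $t$). Put $q_k(t)=\sum_{j=1}^J p_j\,q^j_k(t)$, the probability that a customer is in queue $k$ a time $t$ after arrival. $\mathbf{N}(t)=(N_1(t),\dots,N_J(t))$, where $N_k(t)$ is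 the number of customers in queue $k$ at time $t$. In the vectors $(\cdot,\dots,\cdot,0,\dots,0)$, entries $v+1,\dots,J$ are zero. The negative binomial parameters satisfy $\nu>0$, $r>0$, and $\Gamma$ is the gamma function.
   Formalization: Each customer's process X(s) is additionally assumed jointly measurable in time and outcome with respect to its own sigma-algebra (true for right-continuous paths); otherwise a path independent of the arrival times may still depend on them at the random age t−T_i and the formula fails. *)

theory Defs
  imports "HOL-Probability.Probability"
begin

definition point_count :: "(nat \<Rightarrow> 'a \<Rightarrow> ereal) \<Rightarrow> real set \<Rightarrow> 'a \<Rightarrow> nat" where
  "point_count T A \<omega> = card {i. T i \<omega> \<in> ereal ` A}"

text \<open>
  The points of a non-homogeneous Poisson process on \<open>[0,\<infinity>)\<close> with rate function \<open>\<lambda>\<close>: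
  counts in disjoint bounded Borel sets are independent and Poisson distributed.
  When the total rate is finite there are only finitely many points; the value \<open>\<infinity>\<close> of \<open>T i\<close>
  encodes that the corresponding point does not exist.
  The Poisson law is written out since \<open>poisson_pmf\<close> is only specified for positive means.
\<close>

locale nonhomogeneous_poisson_points = prob_space M
  for M :: "'a measure" +
  fixes lam :: "real \<Rightarrow> real"
    and T :: "nat \<Rightarrow> 'a \<Rightarrow> ereal"
  assumes rate_measurable: "lam \<in> borel_measurable (restrict_space borel {0..})"
    and rate_nonneg: "\<And>\<tau>. 0 \<le> \<tau> \<Longrightarrow> 0 \<le> lam \<tau>"
    and rate_integrable: "\<And>t. 0 \<le> t \<Longrightarrow> set_integrable lborel {0..t} lam"
    and points_measurable: "\<And>i. T i \<in> borel_measurable M"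
    and points_ordered: "AE \<omega> in M. \<forall>i. 0 \<le> T i \<omega> \<and> T i \<omega> \<le> T (Suc i) \<omega>"
    and points_locally_finite: "AE \<omega> in M. \<forall>t. finite {i. T i \<omega> \<le> ereal t}"
    and count_poisson: "\<And>A m. A \<in> sets borel \<Longrightarrow> bounded A \<Longrightarrow> A \<subseteq> {0..} \<Longrightarrow>
          measure M {\<omega> \<in> space M. point_count T A \<omega> = m} =
            (LINT \<tau>:A|lborel. lam \<tau>) ^ m / fact m * exp (- (LINT \<tau>:A|lborel. lam \<tau>))"
    and count_indep: "\<And>A (m :: nat). (\<And>l. l < m \<Longrightarrow> A l \<in> sets borel \<and> bounded (A l) \<and> A l \<subseteq> {0..}) \<Longrightarrow>
          disjoint_family_on A {..<m} \<Longrightarrow>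
          indep_vars (\<lambda>_. count_space UNIV) (\<lambda>l. point_count T (A l)) {..<m}"

definition pgf :: "nat pmf \<Rightarrow> real \<Rightarrow> real" where
  "pgf S z = measure_pmf.expectation S (\<lambda>s. z ^ s)"

definition batch_space :: "nat \<Rightarrow> (nat \<Rightarrow> nat) measure" where
  "batch_space J = (\<Pi>\<^sub>M j\<in>{1..J}. count_space UNIV)"

datatype source = Arrivals | Batch nat | Customer nat nat nat

text \<open>
  The information generated by all arrival times, by the \<open>i\<close>th batch vector, and by the whole
  path \<open>(X j i l s)\<close>, \<open>s \<ge> 0\<close>, of the customer with entry queue \<open>j\<close>, batch \<open>i\<close> and label \<open>l\<close>.
\<close>

fun source_algebra ::
  "'a measure \<Rightarrow> (nat \<Rightarrow> 'a \<Rightarrow> ereal) \<Rightarrow> nat \<Rightarrow> (nat \<Rightarrow> nat \<Rightarrow> 'a \<Rightarrow> nat) \<Rightarrow>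
   (nat \<Rightarrow> nat \<Rightarrow> nat \<Rightarrow> real \<Rightarrow> 'a \<Rightarrow> nat) \<Rightarrow> source \<Rightarrow> 'a measure" where
  "source_algebra M T J B X Arrivals =
     vimage_algebra (space M) (\<lambda>\<omega>. \<lambda>i\<in>UNIV. T i \<omega>) (\<Pi>\<^sub>M i\<in>UNIV. borel)"
| "source_algebra M T J B X (Batch i) =
     vimage_algebra (space M) (\<lambda>\<omega>. \<lambda>j\<in>{1..J}. B i j \<omega>) (batch_space J)"
| "source_algebra M T J B X (Customer j i l) =
     vimage_algebra (space M) (\<lambda>\<omega>. \<lambda>s\<in>{0..}. X j i l s \<omega>) (\<Pi>\<^sub>M s\<in>{0..}. count_space UNIV)"

definition sources :: "nat \<Rightarrow> source set" where
  "sources J = {Arrivals} \<union> range Batch \<union> {Customer j i l | j i l. j \<in> {1..J}}"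

text \<open>
  Queues are numbered \<open>1, \<dots>, J\<close>, whereas batches and the customers within a batch are
  numbered from \<open>0\<close>. \<open>B i j\<close> is the number of customers of batch \<open>i\<close> that enter queue \<open>j\<close>,
  \<open>D\<close> is the law of the generic batch vector, and \<open>S\<close> is the law of the total batch size.
  The value of \<open>X j i l s\<close> is the queue occupied a time \<open>s\<close> after arrival; any value outside
  \<open>{1..J}\<close> means that the customer has left.

  The routing processes have to be measurable stochastic processes. Joint measurability is
  required with respect to the sigma-algebra of the process itself, because independence of that
  sigma-algebra from the arrival times would not otherwise control the process at the random
  age \<open>t - T i\<close>: if \<open>X s = 1\<close> exactly when \<open>s = U\<close>, with \<open>U\<close> uniform on \<open>[0,1]\<close>, then every \<open>X s\<close> is
  almost surely constant, so the path is independent of \<open>U\<close>, and yet \<open>X U = 1\<close>.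
\<close>

locale batch_arrival_network = nonhomogeneous_poisson_points M lam T
  for M :: "'a measure" and lam :: "real \<Rightarrow> real" and T :: "nat \<Rightarrow> 'a \<Rightarrow> ereal" +
  fixes J :: nat
    and D :: "(nat \<Rightarrow> nat) measure"
    and S :: "nat pmf"
    and p :: "nat \<Rightarrow> real"
    and B :: "nat \<Rightarrow> nat \<Rightarrow> 'a \<Rightarrow> nat"
    and X :: "nat \<Rightarrow> nat \<Rightarrow> nat \<Rightarrow> real \<Rightarrow> 'a \<Rightarrow> nat"
    and q :: "nat \<Rightarrow> nat \<Rightarrow> real \<Rightarrow> real"
  assumes entry_nonneg: "\<And>j. j \<in> {1..J} \<Longrightarrow> 0 \<le> p j"
    and entry_sum: "(\<Sum>j=1..J. p j) = 1"
    and batch_measurable: "\<And>i j. j \<in> {1..J} \<Longrightarrow> B i j \<in> measurable M (count_space UNIV)"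
    and batch_law: "\<And>i. distr M (batch_space J) (\<lambda>\<omega>. \<lambda>j\<in>{1..J}. B i j \<omega>) = D"
    and batch_pgf: "\<And>z. (\<And>j. j \<in> {1..J} \<Longrightarrow> z j \<in> {0..1}) \<Longrightarrow>
          (LINT s|D. (\<Prod>j=1..J. z j ^ s j)) = pgf S (\<Sum>j=1..J. p j * z j)"
    and routing_measurable: "\<And>j i l s. j \<in> {1..J} \<Longrightarrow> 0 \<le> s \<Longrightarrow>
          X j i l s \<in> measurable M (count_space UNIV)"
    and routing_jointly_measurable: "\<And>j i l. j \<in> {1..J} \<Longrightarrow>
          (\<lambda>(s, \<omega>). X j i l s \<omega>) \<in> measurable
            (restrict_space borel {0..} \<Otimes>\<^sub>M source_algebra M T J B X (Customer j i l)) (count_space UNIV)"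
    and routing_law: "\<And>j i l k s. j \<in> {1..J} \<Longrightarrow> k \<in> {1..J} \<Longrightarrow> 0 \<le> s \<Longrightarrow>
          measure M {\<omega> \<in> space M. X j i l s \<omega> = k} = q j k s"
    and routing_prob_measurable: "\<And>j k. j \<in> {1..J} \<Longrightarrow> k \<in> {1..J} \<Longrightarrow>
          q j k \<in> borel_measurable (restrict_space borel {0..})"
    and sources_indep: "indep_sets (\<lambda>a. sets (source_algebra M T J B X a)) (sources J)"

definition queue_prob ::
  "nat \<Rightarrow> (nat \<Rightarrow> real) \<Rightarrow> (nat \<Rightarrow> nat \<Rightarrow> real \<Rightarrow> real) \<Rightarrow> nat \<Rightarrow> real \<Rightarrow> real" where
  "queue_prob J p q k s = (\<Sum>j=1..J. p j * q j k s)"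

definition number_in_queue ::
  "(nat \<Rightarrow> 'a \<Rightarrow> ereal) \<Rightarrow> nat \<Rightarrow> (nat \<Rightarrow> nat \<Rightarrow> 'a \<Rightarrow> nat) \<Rightarrow>
   (nat \<Rightarrow> nat \<Rightarrow> nat \<Rightarrow> real \<Rightarrow> 'a \<Rightarrow> nat) \<Rightarrow> real \<Rightarrow> nat \<Rightarrow> 'a \<Rightarrow> nat" where
  "number_in_queue T J B X t k \<omega> =
     card {(i, j, l). T i \<omega> \<le> ereal t \<and> j \<in> {1..J} \<and> l < B i j \<omega> \<and>
                      X j i l (t - real_of_ereal (T i \<omega>)) \<omega> = k}"

definition prob_N ::
  "'a measure \<Rightarrow> (nat \<Rightarrow> 'a \<Rightarrow> ereal) \<Rightarrow> nat \<Rightarrow> (nat \<Rightarrow> nat \<Rightarrow> 'a \<Rightarrow> nat) \<Rightarrow>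
   (nat \<Rightarrow> nat \<Rightarrow> nat \<Rightarrow> real \<Rightarrow> 'a \<Rightarrow> nat) \<Rightarrow> real \<Rightarrow> (nat \<Rightarrow> nat) \<Rightarrow> real" where
  "prob_N M T J B X t m =
     measure M {\<omega> \<in> space M. \<forall>k\<in>{1..J}. number_in_queue T J B X t k \<omega> = m k}"

definition zero_above :: "nat \<Rightarrow> (nat \<Rightarrow> nat) \<Rightarrow> nat \<Rightarrow> nat" where
  "zero_above v n = (\<lambda>k. if k \<le> v then n k else 0)"

end

theory Submission
  imports Defs
begin

text \<open>
  Classify every batch that has arrived by time \<open>t\<close> by its occupancy vector \<open>y\<close>: the number of its
  customers in each queue at time \<open>t\<close>. By independent marking, the numbers \<open>K y\<close> of batches with
  vector \<open>y\<close> are independent Poisson variables with means \<open>\<eta> y = \<integral> \<lambda>(\<tau>) f (t - \<tau>) y d\<tau>\<close> over \<open>[0,t]\<close>,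
  where \<open>f s\<close> is the law of the occupancy vector of a batch of age \<open>s\<close>, and \<open>N(t) = \<Sum>y. K y \<cdot> y\<close>.
  Since \<open>c \<cdot> \<eta> ^ c / c! = \<eta> \<cdot> \<eta> ^ (c - 1) / (c - 1)!\<close>, they satisfy \<open>E[K y; N = n] = \<eta> y \<cdot> P(N = n - y)\<close>, whence
  \<open>n v \<cdot> P(N = n) = E[N v; N = n] = (\<Sum>y. y v \<cdot> E[K y; N = n]) = (\<Sum>y. y v \<cdot> \<eta> y \<cdot> P(N = n - y))\<close>.
  This is lemma \<open>prob_N_recursion\<close>. Only the finitely many \<open>y \<le> n\<close> matter: a batch with any other vector
  excludes \<open>N = n\<close>, and a batch with vector \<open>0\<close> does not contribute to \<open>N\<close>.

  The marking property is obtained from generating functions. Given the arrival times the batches are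
  independent, so the expectation of \<open>\<Prod>i. w (y\<^sub>i)\<close> over the arrived batches is the expectation of
  \<open>\<Prod>i. g (T\<^sub>i)\<close> with \<open>g \<tau> = \<Sum>y. w y \<cdot> f (t - \<tau>) y\<close>. For a step function \<open>g\<close> the latter expectation follows
  from the independent Poisson counts, and a limit gives \<open>exp (\<integral> \<lambda>(\<tau>) (g \<tau> - 1) d\<tau>)\<close> in general. Since
  this factorises over \<open>y\<close>, the joint law of the \<open>K y\<close> can be read off one variable at a time
  (\<open>poisson_weights_from_pgf\<close>), so that no theory of multivariate power series is involved.

  For the negative binomial batch size the law \<open>f s\<close> is negative multinomial. It is read off in the same
  way, one queue at a time, from the generating function \<open>G(1 - \<Sum>k. (1 - z k) q\<^sub>k(s))\<close> of the occupancy
  vector, using the binomial series of \<open>(a - b x) powr (-r)\<close>.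
\<close>

section \<open>Coefficients of generating functions\<close>

text \<open>
  Probability generating functions are only given on \<open>[0,1]\<close>, so the identity theorem is needed for
  power series that agree to the right of \<open>0\<close>. Once the lower coefficients of the difference vanish, a
  power of \<open>x\<close> can be divided out, and the next coefficient is the limit at \<open>0\<close>.
\<close>

lemma power_series_unique_right:
  fixes a b :: "nat \<Rightarrow> real"
  assumes a: "\<And>x. 0 < x \<Longrightarrow> x < 1 \<Longrightarrow> (\<lambda>k. a k * x ^ k) sums f x"
    and b: "\<And>x. 0 < x \<Longrightarrow> x < 1 \<Longrightarrow> (\<lambda>k. b k * x ^ k) sums f x"
  shows "a k = b k"
proof -
  define d where "d k = a k - b k" for k
  have d0: "(\<lambda>k. d k * x ^ k) sums 0" if "0 < x" "x < 1" for x
    using sums_diff[OF a[OF that] b[OF that]] by (simp add: d_def algebra_simps)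
  have "d k = 0"
  proof (induction k rule: less_induct)
    case (less k)
    have tail: "(\<lambda>i. d (i + k) * x ^ i) sums 0" if "0 < x" "x < 1" for x
    proof -
      have "(\<lambda>i. d (i + k) * x ^ (i + k)) sums (0 - (\<Sum>i<k. d i * x ^ i))"
        by (rule sums_split_initial_segment[OF d0[OF that]])
      then have "(\<lambda>i. (d (i + k) * x ^ (i + k)) / x ^ k) sums (0 / x ^ k)"
        using less by (intro sums_divide) simp
      then show ?thesis using that by (simp add: power_add)
    qed
    define g where "g x = (\<Sum>i. d (i + k) * x ^ i)" for x :: real
    have sumg: "(\<lambda>i. d (i + k) * x ^ i) sums g x" if "norm x < 1/2" for x
    proof -
      have "summable (\<lambda>i. d (i + k) * (1/2) ^ i)"
        using tail[of "1/2"] by (auto dest: sums_summable)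
      then have "summable (\<lambda>i. d (i + k) * x ^ i)"
        by (rule powser_inside) (use that in simp)
      then show ?thesis by (simp add: g_def summable_sums)
    qed
    have "(g \<longlongrightarrow> d (0 + k)) (at 0)"
      by (rule powser_limit_0[of "1/2" "\<lambda>i. d (i + k)"]) (use sumg in auto)
    then have "(g \<longlongrightarrow> d k) (at_right 0)"
      using filterlim_at_split by force
    moreover have "eventually (\<lambda>x. g x = 0) (at_right 0)"
      unfolding eventually_at_right_field
    proof (intro exI[of _ "1/2"] conjI allI impI)
      fix x :: real assume "0 < x" "x < 1/2"
      then show "g x = 0" using tail[of x] sumg[of x] sums_unique2 by fastforce
    qed simp
    ultimately have "((\<lambda>x. 0) \<longlongrightarrow> d k) (at_right (0::real))"
      by (rule Lim_transform_eventually)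
    then show "d k = 0"
      by (simp add: tendsto_const_iff)
  qed
  then show ?thesis by (simp add: d_def)
qed

lemma (in prob_space) expectation_power_sums:
  fixes K :: "'a \<Rightarrow> nat" and Z :: "'a \<Rightarrow> real"
  assumes K [measurable]: "K \<in> measurable M (count_space UNIV)"
    and Z [measurable]: "Z \<in> borel_measurable M"
    and Z01: "\<And>\<omega>. 0 \<le> Z \<omega>" "\<And>\<omega>. Z \<omega> \<le> 1"
    and x: "0 \<le> x" "x \<le> 1"
  shows "(\<lambda>c. expectation (\<lambda>\<omega>. Z \<omega> * of_bool (K \<omega> = c)) * x ^ c)
           sums expectation (\<lambda>\<omega>. Z \<omega> * x ^ K \<omega>)"
proof -
  have xp: "0 \<le> x ^ k" "x ^ k \<le> 1" for k using x by (auto intro: power_le_one)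
  have int: "integrable M (\<lambda>\<omega>. Z \<omega> * of_bool (K \<omega> = c))" for c
    by (rule integrable_const_bound[where B=1]) (use Z01 in auto)
  have eq: "(\<Sum>c<n. Z \<omega> * of_bool (K \<omega> = c) * x ^ c) = Z \<omega> * x ^ K \<omega> * of_bool (K \<omega> < n)" for n \<omega>
  proof -
    have "(\<Sum>c<n. Z \<omega> * of_bool (K \<omega> = c) * x ^ c) = (\<Sum>c<n. if c = K \<omega> then Z \<omega> * x ^ c else 0)"
      by (intro sum.cong) auto
    then show ?thesis by (simp add: sum.delta)
  qed
  have "(\<lambda>n. expectation (\<lambda>\<omega>. \<Sum>c<n. Z \<omega> * of_bool (K \<omega> = c) * x ^ c)) \<longlonglongrightarrow> expectation (\<lambda>\<omega>. Z \<omega> * x ^ K \<omega>)"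
  proof (rule integral_dominated_convergence[where w="\<lambda>_. 1"])
    show "AE \<omega> in M. (\<lambda>n. \<Sum>c<n. Z \<omega> * of_bool (K \<omega> = c) * x ^ c) \<longlonglongrightarrow> Z \<omega> * x ^ K \<omega>"
    proof (rule AE_I2)
      fix \<omega>
      have "eventually (\<lambda>n. Z \<omega> * x ^ K \<omega> = (\<Sum>c<n. Z \<omega> * of_bool (K \<omega> = c) * x ^ c)) sequentially"
        using eventually_gt_at_top[of "K \<omega>"] by eventually_elim (simp only: eq, simp)
      then show "(\<lambda>n. \<Sum>c<n. Z \<omega> * of_bool (K \<omega> = c) * x ^ c) \<longlonglongrightarrow> Z \<omega> * x ^ K \<omega>"
        by (rule Lim_transform_eventually[OF tendsto_const])
    qed
    show "AE \<omega> in M. norm (\<Sum>c<n. Z \<omega> * of_bool (K \<omega> = c) * x ^ c) \<le> 1" for n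
      unfolding eq using Z01 xp by (auto simp: abs_mult intro!: mult_le_one)
  qed auto
  also have "(\<lambda>n. expectation (\<lambda>\<omega>. \<Sum>c<n. Z \<omega> * of_bool (K \<omega> = c) * x ^ c))
      = (\<lambda>n. \<Sum>c<n. expectation (\<lambda>\<omega>. Z \<omega> * of_bool (K \<omega> = c)) * x ^ c)"
    using int by (simp add: Bochner_Integration.integral_sum)
  finally show ?thesis by (simp add: sums_def)
qed

text \<open>
  The weight \<open>Z\<close> may contain powers or indicators of further variables; this allows a joint law to be
  extracted from a multivariate generating function in one variable after the other.
\<close>

lemma (in prob_space) expectation_power_coefficient:
  fixes K :: "'a \<Rightarrow> nat" and Z :: "'a \<Rightarrow> real"
  assumes "K \<in> measurable M (count_space UNIV)"
    and "Z \<in> borel_measurable M"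
    and "\<And>\<omega>. 0 \<le> Z \<omega>" "\<And>\<omega>. Z \<omega> \<le> 1"
    and "\<And>x. 0 < x \<Longrightarrow> x < 1 \<Longrightarrow> (\<lambda>c. \<alpha> c * x ^ c) sums expectation (\<lambda>\<omega>. Z \<omega> * x ^ K \<omega>)"
  shows "expectation (\<lambda>\<omega>. Z \<omega> * of_bool (K \<omega> = c)) = \<alpha> c"
  by (rule power_series_unique_right[where f="\<lambda>x. expectation (\<lambda>\<omega>. Z \<omega> * x ^ K \<omega>)"])
     (use assms in \<open>auto intro!: expectation_power_sums\<close>)

text \<open>
  The induction replaces the factors \<open>w y ^ K y\<close> by indicators of \<open>K y = c y\<close>, first for the empty set
  \<open>A\<close> and finally for \<open>A = F\<close>. The right-hand side stays a product throughout, so each step expands a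
  single exponential. The sub-probability weight \<open>Z\<close> leaves room for an event other than the counts.
\<close>

lemma (in prob_space) poisson_weights_from_pgf:
  fixes K :: "'i \<Rightarrow> 'a \<Rightarrow> nat" and Z :: "'a \<Rightarrow> real"
  assumes F: "finite F"
    and K [measurable]: "\<And>y. y \<in> F \<Longrightarrow> K y \<in> measurable M (count_space UNIV)"
    and Z [measurable]: "Z \<in> borel_measurable M"
    and Z01: "\<And>\<omega>. 0 \<le> Z \<omega>" "\<And>\<omega>. Z \<omega> \<le> 1"
    and pgf: "\<And>w. (\<And>y. y \<in> F \<Longrightarrow> 0 \<le> w y \<and> w y \<le> 1) \<Longrightarrow>
       expectation (\<lambda>\<omega>. Z \<omega> * (\<Prod>y\<in>F. w y ^ K y \<omega>)) = C * (\<Prod>y\<in>F. exp (\<eta> y * w y))"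
  shows "expectation (\<lambda>\<omega>. Z \<omega> * (\<Prod>y\<in>F. of_bool (K y \<omega> = c y))) = C * (\<Prod>y\<in>F. \<eta> y ^ c y / fact (c y))"
proof -
  have "expectation (\<lambda>\<omega>. Z \<omega> * (\<Prod>y\<in>A. of_bool (K y \<omega> = c y)) * (\<Prod>y\<in>F - A. w y ^ K y \<omega>)) =
       C * (\<Prod>y\<in>A. \<eta> y ^ c y / fact (c y)) * (\<Prod>y\<in>F - A. exp (\<eta> y * w y))"
    if "A \<subseteq> F" "\<And>y. y \<in> F \<Longrightarrow> 0 \<le> w y \<and> w y \<le> 1" for A w
    using finite_subset[OF that(1) F] that
  proof (induction A arbitrary: w)
    case empty
    then show ?case using pgf[of w] by simp
  next
    case (insert a A)
    define Z' where "Z' \<omega> = Z \<omega> * (\<Prod>y\<in>A. of_bool (K y \<omega> = c y)) * (\<Prod>y\<in>F - insert a A. w y ^ K y \<omega>)" for \<omega>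
    define C' where "C' = C * (\<Prod>y\<in>A. \<eta> y ^ c y / fact (c y)) * (\<Prod>y\<in>F - insert a A. exp (\<eta> y * w y))"
    have aF: "a \<in> F" and AF: "A \<subseteq> F" using insert.prems by auto
    have FA: "F - A = insert a (F - insert a A)" using insert aF by auto
    have w01: "0 \<le> w y ^ k" "w y ^ k \<le> 1" if "y \<in> F" for y k
      using insert.prems(2)[OF that] by (auto intro: power_le_one)
    have P1: "0 \<le> (\<Prod>y\<in>F - insert a A. w y ^ K y \<omega>)" "(\<Prod>y\<in>F - insert a A. w y ^ K y \<omega>) \<le> 1" for \<omega>
      using w01 by (auto intro!: prod_nonneg prod_le_1)
    have P2: "0 \<le> (\<Prod>y\<in>A. of_bool (K y \<omega> = c y) :: real)" "(\<Prod>y\<in>A. of_bool (K y \<omega> = c y) :: real) \<le> 1" for \<omega>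
      by (auto intro!: prod_nonneg prod_le_1)
    have Z'm: "Z' \<in> borel_measurable M"
      unfolding Z'_def using AF by (intro borel_measurable_times borel_measurable_prod) (auto)
    have "expectation (\<lambda>\<omega>. Z' \<omega> * of_bool (K a \<omega> = c a)) = C' * (\<eta> a ^ c a / fact (c a))"
    proof (rule expectation_power_coefficient[OF K[OF aF] Z'm])
      show "0 \<le> Z' \<omega>" for \<omega> unfolding Z'_def using Z01 P1 P2 by simp
      show "Z' \<omega> \<le> 1" for \<omega> unfolding Z'_def using Z01 P1 P2 by (intro mult_le_one mult_nonneg_nonneg)
      fix x :: real assume x: "0 < x" "x < 1"
      have "expectation (\<lambda>\<omega>. Z \<omega> * (\<Prod>y\<in>A. of_bool (K y \<omega> = c y)) * (\<Prod>y\<in>F - A. (w(a := x)) y ^ K y \<omega>))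
         = C * (\<Prod>y\<in>A. \<eta> y ^ c y / fact (c y)) * (\<Prod>y\<in>F - A. exp (\<eta> y * (w(a := x)) y))"
        using AF insert.prems(2) x by (intro insert.IH) auto
      also have "(\<lambda>\<omega>. Z \<omega> * (\<Prod>y\<in>A. of_bool (K y \<omega> = c y)) * (\<Prod>y\<in>F - A. (w(a := x)) y ^ K y \<omega>)) = (\<lambda>\<omega>. Z' \<omega> * x ^ K a \<omega>)"
        unfolding FA Z'_def using F by (auto simp: fun_eq_iff intro!: prod.cong)
      also have "C * (\<Prod>y\<in>A. \<eta> y ^ c y / fact (c y)) * (\<Prod>y\<in>F - A. exp (\<eta> y * (w(a := x)) y)) = C' * exp (\<eta> a * x)"
        unfolding FA C'_def using F by (auto intro!: prod.cong)
      finally have *: "expectation (\<lambda>\<omega>. Z' \<omega> * x ^ K a \<omega>) = C' * exp (\<eta> a * x)" .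
      have "(\<lambda>k. C' * ((\<eta> a * x) ^ k /\<^sub>R fact k)) sums (C' * exp (\<eta> a * x))"
        by (intro sums_mult exp_converges)
      then show "(\<lambda>k. C' * (\<eta> a ^ k / fact k) * x ^ k) sums expectation (\<lambda>\<omega>. Z' \<omega> * x ^ K a \<omega>)"
        unfolding * by (simp add: power_mult_distrib field_simps)
    qed
    moreover have "(\<lambda>\<omega>. Z \<omega> * (\<Prod>y\<in>insert a A. of_bool (K y \<omega> = c y)) * (\<Prod>y\<in>F - insert a A. w y ^ K y \<omega>))
        = (\<lambda>\<omega>. Z' \<omega> * of_bool (K a \<omega> = c a))"
      using insert.hyps by (simp add: Z'_def fun_eq_iff)
    moreover have "C * (\<Prod>y\<in>insert a A. \<eta> y ^ c y / fact (c y)) * (\<Prod>y\<in>F - insert a A. exp (\<eta> y * w y))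
        = C' * (\<eta> a ^ c a / fact (c a))"
      using insert.hyps by (simp add: C'_def)
    ultimately show ?case by (simp only:)
  qed
  from this[of F "\<lambda>_. 1"] show ?thesis by simp
qed

section \<open>The generating functional of the Poisson points\<close>

context nonhomogeneous_poisson_points
begin

lemma point_count_measurable [measurable]:
  assumes "A \<in> sets borel" "bounded A" "A \<subseteq> {0..}"
  shows "point_count T A \<in> measurable M (count_space UNIV)"
proof -
  have "indep_vars (\<lambda>_. count_space UNIV) (\<lambda>l. point_count T A) {..<1::nat}"
    using assms by (intro count_indep) (auto simp: disjoint_family_on_def)
  then show ?thesis unfolding indep_vars_def by auto
qed

lemma point_count_pgf:
  assumes A: "A \<in> sets borel" "bounded A" "A \<subseteq> {0..}" and x: "0 \<le> x" "x \<le> 1"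
  shows "expectation (\<lambda>\<omega>. x ^ point_count T A \<omega>) = exp ((x - 1) * (LINT \<tau>:A|lborel. lam \<tau>))"
proof -
  define L where "L = (LINT \<tau>:A|lborel. lam \<tau>)"
  note [measurable] = point_count_measurable[OF A]
  have E: "expectation (\<lambda>\<omega>. 1 * of_bool (point_count T A \<omega> = c)) = L ^ c / fact c * exp (- L)" for c
  proof -
    have "expectation (\<lambda>\<omega>. 1 * of_bool (point_count T A \<omega> = c))
        = expectation (indicat_real {\<omega> \<in> space M. point_count T A \<omega> = c})"
      by (intro Bochner_Integration.integral_cong) (auto simp: indicator_def)
    also have "\<dots> = measure M {\<omega> \<in> space M. point_count T A \<omega> = c}" by simp
    finally show ?thesis using count_poisson[OF A] by (simp add: L_def)
  qed
  have "(\<lambda>c. expectation (\<lambda>\<omega>. 1 * of_bool (point_count T A \<omega> = c)) * x ^ c)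
      sums expectation (\<lambda>\<omega>. 1 * x ^ point_count T A \<omega>)"
    using x by (intro expectation_power_sums) auto
  then have 1: "(\<lambda>c. L ^ c / fact c * exp (- L) * x ^ c) sums expectation (\<lambda>\<omega>. x ^ point_count T A \<omega>)"
    unfolding E by simp
  have "(\<lambda>k. exp (- L) * ((L * x) ^ k /\<^sub>R fact k)) sums (exp (- L) * exp (L * x))"
    by (intro sums_mult exp_converges)
  then have "(\<lambda>c. L ^ c / fact c * exp (- L) * x ^ c) sums (exp (- L) * exp (L * x))"
    by (simp add: power_mult_distrib field_simps)
  with 1 have "expectation (\<lambda>\<omega>. x ^ point_count T A \<omega>) = exp (- L) * exp (L * x)"
    by (rule sums_unique2)
  then show ?thesis by (simp add: L_def exp_add[symmetric] algebra_simps)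
qed

lemma rate_set_integrable:
  assumes "0 \<le> t" "A \<in> sets borel" "A \<subseteq> {0..t}"
  shows "set_integrable lborel A lam"
  using set_integrable_subset[OF rate_integrable[OF assms(1)], of A] assms by simp

lemma rate_bounded_set_integrable:
  fixes g :: "real \<Rightarrow> real"
  assumes t: "0 \<le> t" and g: "set_borel_measurable lborel {0..t} g"
    and b: "\<And>\<tau>. \<tau> \<in> {0..t} \<Longrightarrow> \<bar>g \<tau>\<bar> \<le> 1"
  shows "set_integrable lborel {0..t} (\<lambda>\<tau>. lam \<tau> * g \<tau>)"
  unfolding set_integrable_def
proof (rule Bochner_Integration.integrable_bound)
  show "integrable lborel (\<lambda>\<tau>. indicator {0..t} \<tau> *\<^sub>R lam \<tau>)"
    using rate_integrable[OF t] by (simp add: set_integrable_def)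
  then have "(\<lambda>\<tau>. (indicator {0..t} \<tau> *\<^sub>R lam \<tau>) * (indicator {0..t} \<tau> *\<^sub>R g \<tau>)) \<in> borel_measurable lborel"
    using g by (intro borel_measurable_times) (auto simp: set_borel_measurable_def)
  also have "(\<lambda>\<tau>. (indicator {0..t} \<tau> *\<^sub>R lam \<tau>) * (indicator {0..t} \<tau> *\<^sub>R g \<tau>)) = (\<lambda>\<tau>. indicator {0..t} \<tau> *\<^sub>R (lam \<tau> * g \<tau>))"
    by (auto simp: indicator_def)
  finally show "(\<lambda>\<tau>. indicator {0..t} \<tau> *\<^sub>R (lam \<tau> * g \<tau>)) \<in> borel_measurable lborel" .
  show "AE \<tau> in lborel. norm (indicator {0..t} \<tau> *\<^sub>R (lam \<tau> * g \<tau>)) \<le> norm (indicator {0..t} \<tau> *\<^sub>R lam \<tau>)"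
    using b by (auto simp: indicator_def abs_mult intro!: mult_left_le AE_I2)
qed

text \<open>
  The product of \<open>g (T i)\<close> for a step function \<open>g\<close> with value \<open>x l\<close> on \<open>A l\<close> is a product of powers of
  independent counts, so the Poisson generating functions multiply.
\<close>

lemma laplace_functional_step:
  fixes A :: "nat \<Rightarrow> real set" and x :: "nat \<Rightarrow> real"
  assumes A: "\<And>l. l < m \<Longrightarrow> A l \<in> sets borel \<and> bounded (A l) \<and> A l \<subseteq> {0..}"
    and disj: "disjoint_family_on A {..<m}"
    and x: "\<And>l. l < m \<Longrightarrow> 0 \<le> x l \<and> x l \<le> 1"
  shows "expectation (\<lambda>\<omega>. \<Prod>l<m. x l ^ point_count T (A l) \<omega>)
       = exp (\<Sum>l<m. (x l - 1) * (LINT \<tau>:A l|lborel. lam \<tau>))"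
proof -
  have "indep_vars (\<lambda>_. borel) (\<lambda>l \<omega>. x l ^ point_count T (A l) \<omega>) {..<m}"
    by (rule indep_vars_compose2[OF count_indep[OF A disj]]) auto
  then have "expectation (\<lambda>\<omega>. \<Prod>l<m. x l ^ point_count T (A l) \<omega>)
      = (\<Prod>l<m. expectation (\<lambda>\<omega>. x l ^ point_count T (A l) \<omega>))"
  proof (rule indep_vars_lebesgue_integral[rotated])
    fix l assume l: "l \<in> {..<m}"
    then have [measurable]: "point_count T (A l) \<in> measurable M (count_space UNIV)"
      using A by (intro point_count_measurable) auto
    show "integrable M (\<lambda>\<omega>. x l ^ point_count T (A l) \<omega>)"
      by (rule integrable_const_bound[where B=1]) (use l x in \<open>auto intro: power_le_one\<close>)
  qed simp
  also have "\<dots> = (\<Prod>l<m. exp ((x l - 1) * (LINT \<tau>:A l|lborel. lam \<tau>)))"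
    using A x by (intro prod.cong refl point_count_pgf) auto
  finally show ?thesis by (simp add: exp_sum)
qed

definition arrived :: "real \<Rightarrow> 'a \<Rightarrow> nat set" where
  "arrived t \<omega> = {i. T i \<omega> \<le> ereal t}"

text \<open>
  The arrival times are extended reals; almost surely all of those up to \<open>t\<close> are real numbers in \<open>[0,t]\<close>.
\<close>

lemma arrived_AE:
  "AE \<omega> in M. finite (arrived t \<omega>) \<and> (\<forall>i\<in>arrived t \<omega>. T i \<omega> = ereal (real_of_ereal (T i \<omega>)) \<and> real_of_ereal (T i \<omega>) \<in> {0..t})"
  using points_locally_finite points_ordered
proof eventually_elim
  case (elim \<omega>)
  have "T i \<omega> = ereal (real_of_ereal (T i \<omega>)) \<and> real_of_ereal (T i \<omega>) \<in> {0..t}" if "T i \<omega> \<le> ereal t" for i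
    using elim(2)[rule_format, of i] that by (cases "T i \<omega>") auto
  then show ?case using elim(1) by (auto simp: arrived_def)
qed

lemma arrived_prod_simple:
  assumes fin: "finite (arrived t \<omega>)"
    and T: "\<forall>i\<in>arrived t \<omega>. T i \<omega> = ereal (real_of_ereal (T i \<omega>)) \<and> real_of_ereal (T i \<omega>) \<in> {0..t}"
    and \<kappa>: "\<And>\<tau>. \<tau> \<in> {0..t} \<Longrightarrow> \<kappa> \<tau> < (m::nat)"
  shows "(\<Prod>i\<in>arrived t \<omega>. x (\<kappa> (real_of_ereal (T i \<omega>)))) =
         (\<Prod>l<m. (x l :: real) ^ point_count T {\<tau> \<in> {0..t}. \<kappa> \<tau> = l} \<omega>)"
proof -
  have "(\<Prod>i\<in>arrived t \<omega>. x (\<kappa> (real_of_ereal (T i \<omega>)))) =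
     (\<Prod>l<m. \<Prod>i\<in>{i \<in> arrived t \<omega>. \<kappa> (real_of_ereal (T i \<omega>)) = l}. x (\<kappa> (real_of_ereal (T i \<omega>))))"
    using \<kappa> T by (intro prod.group[symmetric] fin) auto
  also have "\<dots> = (\<Prod>l<m. x l ^ card {i \<in> arrived t \<omega>. \<kappa> (real_of_ereal (T i \<omega>)) = l})"
    by (intro prod.cong refl) simp
  also have "\<dots> = (\<Prod>l<m. x l ^ point_count T {\<tau> \<in> {0..t}. \<kappa> \<tau> = l} \<omega>)"
  proof -
    have "{i \<in> arrived t \<omega>. \<kappa> (real_of_ereal (T i \<omega>)) = l} = {i. T i \<omega> \<in> ereal ` {\<tau> \<in> {0..t}. \<kappa> \<tau> = l}}" for l
      using T by (auto simp: arrived_def image_iff)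
    then show ?thesis by (simp add: point_count_def)
  qed
  finally show ?thesis .
qed

lemma arrived_prod_eventually:
  assumes "finite (arrived t \<omega>)"
  shows "eventually (\<lambda>m. (\<Prod>i<m. if T i \<omega> \<le> ereal t then h i else 1) = (\<Prod>i\<in>arrived t \<omega>. h i :: real)) sequentially"
proof -
  obtain m where m: "\<forall>i\<in>arrived t \<omega>. i < m" using assms finite_nat_set_iff_bounded by auto
  have "(\<Prod>i<k. if T i \<omega> \<le> ereal t then h i else 1) = (\<Prod>i\<in>arrived t \<omega>. h i)" if "k \<ge> m" for k
  proof -
    have "arrived t \<omega> = {i \<in> {..<k}. T i \<omega> \<le> ereal t}" using m that by (auto simp: arrived_def)
    then show ?thesis by (simp add: prod.inter_filter[symmetric])
  qed
  then show ?thesis by (auto simp: eventually_sequentially)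
qed

lemma finite_arrived_iff: "finite (arrived t \<omega>) \<longleftrightarrow> (\<exists>m. \<forall>i\<ge>m. \<not> T i \<omega> \<le> ereal t)"
  unfolding finite_nat_set_iff_bounded arrived_def by (auto simp: not_le) (meson not_le)+

text \<open>
  The index set is random. On the event that it is finite the product is a limit of products over
  fixed index sets; otherwise it is an infinite product, which has the value \<open>1\<close> by convention.
\<close>

lemma arrived_prod_measurable:
  fixes h :: "nat \<Rightarrow> 'a \<Rightarrow> real"
  assumes [measurable]: "\<And>i. h i \<in> borel_measurable M"
  shows "(\<lambda>\<omega>. \<Prod>i\<in>arrived t \<omega>. h i \<omega>) \<in> borel_measurable M"
proof -
  note [measurable] = points_measurable
  have "(\<lambda>\<omega>. \<Prod>i\<in>arrived t \<omega>. h i \<omega>) =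
    (\<lambda>\<omega>. if \<exists>m. \<forall>i\<ge>m. \<not> T i \<omega> \<le> ereal t
         then lim (\<lambda>m. \<Prod>i<m. if T i \<omega> \<le> ereal t then h i \<omega> else 1) else 1)"
  proof (rule ext)
    fix \<omega>
    show "(\<Prod>i\<in>arrived t \<omega>. h i \<omega>) =
      (if \<exists>m. \<forall>i\<ge>m. \<not> T i \<omega> \<le> ereal t
         then lim (\<lambda>m. \<Prod>i<m. if T i \<omega> \<le> ereal t then h i \<omega> else 1) else 1)"
    proof (cases "finite (arrived t \<omega>)")
      case True
      have "(\<lambda>m. \<Prod>i<m. if T i \<omega> \<le> ereal t then h i \<omega> else 1) \<longlonglongrightarrow> (\<Prod>i\<in>arrived t \<omega>. h i \<omega>)"
        by (rule tendsto_eventually[OF arrived_prod_eventually[OF True]])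
      then show ?thesis using True finite_arrived_iff by (simp add: limI)
    next
      case False
      then have "\<not> (\<exists>m. \<forall>i\<ge>m. \<not> T i \<omega> \<le> ereal t)" unfolding finite_arrived_iff .
      then show ?thesis unfolding prod.infinite[OF False] by (rule if_not_P[symmetric])
    qed
  qed
  moreover have "(\<lambda>\<omega>. if \<exists>m. \<forall>i\<ge>m. \<not> T i \<omega> \<le> ereal t
         then lim (\<lambda>m. \<Prod>i<m. if T i \<omega> \<le> ereal t then h i \<omega> else 1) else 1) \<in> borel_measurable M"
    by measurable
  ultimately show ?thesis by simp
qed

lemma arrived_prod_limit:
  fixes h :: "nat \<Rightarrow> 'a \<Rightarrow> real"
  assumes [measurable]: "\<And>i. h i \<in> borel_measurable M"
    and h01: "\<And>i \<omega>. 0 \<le> h i \<omega>" "\<And>i \<omega>. h i \<omega> \<le> 1"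
  shows "(\<lambda>m. expectation (\<lambda>\<omega>. \<Prod>i<m. if T i \<omega> \<le> ereal t then h i \<omega> else 1))
     \<longlonglongrightarrow> expectation (\<lambda>\<omega>. \<Prod>i\<in>arrived t \<omega>. h i \<omega>)"
proof (rule integral_dominated_convergence[where w="\<lambda>_. 1"])
  note [measurable] = points_measurable
  show "(\<lambda>\<omega>. \<Prod>i<m. if T i \<omega> \<le> ereal t then h i \<omega> else 1) \<in> borel_measurable M" for m
    by measurable
  show "AE \<omega> in M. (\<lambda>m. \<Prod>i<m. if T i \<omega> \<le> ereal t then h i \<omega> else 1) \<longlonglongrightarrow> (\<Prod>i\<in>arrived t \<omega>. h i \<omega>)"
    using arrived_AE[of t] by eventually_elim (auto intro: tendsto_eventually arrived_prod_eventually)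
  show "AE \<omega> in M. norm (\<Prod>i<m. if T i \<omega> \<le> ereal t then h i \<omega> else 1) \<le> 1" for m
    using h01 by (auto simp: abs_prod intro!: prod_le_1 AE_I2)
qed (auto intro: arrived_prod_measurable)

text \<open>
  Rounding \<open>g\<close> down to multiples of \<open>1 / (N + 1)\<close> gives step functions \<open>gN N\<close> with level sets \<open>A N l\<close>,
  which converge to \<open>g\<close>. Dominated convergence applies on both sides because almost surely only
  finitely many points have arrived and the rate is integrable.
\<close>

lemma laplace_functional:
  fixes g :: "real \<Rightarrow> real"
  assumes t: "0 \<le> t" and g [measurable]: "g \<in> borel_measurable borel"
    and g01: "\<And>\<tau>. 0 \<le> g \<tau>" "\<And>\<tau>. g \<tau> \<le> 1"
  shows "expectation (\<lambda>\<omega>. \<Prod>i\<in>arrived t \<omega>. g (real_of_ereal (T i \<omega>)))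
       = exp (LINT \<tau>:{0..t}|lborel. lam \<tau> * (g \<tau> - 1))"
    and "(\<lambda>\<omega>. \<Prod>i\<in>arrived t \<omega>. g (real_of_ereal (T i \<omega>))) \<in> borel_measurable M" (is ?meas)
proof -
  define \<kappa> where "\<kappa> N \<tau> = nat \<lfloor>real (Suc N) * g \<tau>\<rfloor>" for N \<tau>
  define x where "x N l = real l / real (Suc N)" for N l
  define gN where "gN N \<tau> = x N (\<kappa> N \<tau>)" for N \<tau>
  define A where "A N l = {\<tau> \<in> {0..t}. \<kappa> N \<tau> = l}" for N l
  have A_meas: "A N l \<in> sets borel" for N l
    unfolding A_def \<kappa>_def by measurable
  have \<kappa>_le: "\<kappa> N \<tau> < Suc (Suc N)" for N \<tau>
  proof -
    have "real (Suc N) * g \<tau> \<le> real (Suc N)" using g01[of \<tau>] by (simp add: mult_left_le)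
    then have "\<lfloor>real (Suc N) * g \<tau>\<rfloor> \<le> int (Suc N)" by (metis floor_mono floor_of_nat)
    then show ?thesis unfolding \<kappa>_def by linarith
  qed
  have gN_conv: "(\<lambda>N. gN N \<tau>) \<longlonglongrightarrow> g \<tau>" for \<tau>
  proof (rule LIMSEQ_norm_0[of "\<lambda>N. gN N \<tau> - g \<tau>", THEN LIM_zero_cancel])
    fix N
    have "\<bar>real (\<kappa> N \<tau>) - real (Suc N) * g \<tau>\<bar> < 1"
      unfolding \<kappa>_def using g01(1)[of \<tau>] by (simp) linarith
    then have "\<bar>real (\<kappa> N \<tau>) - real (Suc N) * g \<tau>\<bar> / real (Suc N) < 1 / real (Suc N)"
      by (intro divide_strict_right_mono) auto
    also have "\<bar>real (\<kappa> N \<tau>) - real (Suc N) * g \<tau>\<bar> / real (Suc N) = \<bar>(real (\<kappa> N \<tau>) - real (Suc N) * g \<tau>) / real (Suc N)\<bar>"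
      by simp
    also have "(real (\<kappa> N \<tau>) - real (Suc N) * g \<tau>) / real (Suc N) = gN N \<tau> - g \<tau>"
      unfolding gN_def x_def by (simp add: diff_divide_distrib)
    finally show "norm (gN N \<tau> - g \<tau>) < 1 / real (Suc N)" by simp
  qed
  have gN01: "0 \<le> gN N \<tau>" "gN N \<tau> \<le> 1" for N \<tau>
    using \<kappa>_le[of N \<tau>] by (auto simp: gN_def x_def)
  have gN_meas [measurable]: "gN N \<in> borel_measurable borel" for N
    unfolding gN_def x_def \<kappa>_def by measurable
  define P where "P N \<omega> = (\<Prod>l<Suc (Suc N). x N l ^ point_count T (A N l) \<omega>)" for N \<omega>
  have A_ok: "A N l \<in> sets borel \<and> bounded (A N l) \<and> A N l \<subseteq> {0..}" for N l
    using A_meas by (auto simp: A_def intro: bounded_subset[of "{0..t}"])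
  have P_meas [measurable]: "P N \<in> borel_measurable M" for N
  proof -
    have [measurable]: "point_count T (A N l) \<in> measurable M (count_space UNIV)" for l
      using A_ok by (intro point_count_measurable) auto
    show ?thesis unfolding P_def by measurable
  qed
  have P_eq: "AE \<omega> in M. \<forall>N. P N \<omega> = (\<Prod>i\<in>arrived t \<omega>. gN N (real_of_ereal (T i \<omega>)))"
    using arrived_AE[of t]
  proof eventually_elim
    case (elim \<omega>)
    show ?case
      unfolding P_def gN_def A_def
      by (intro allI arrived_prod_simple[symmetric] conjunct1[OF elim] conjunct2[OF elim] \<kappa>_le)
  qed
  have P_conv: "AE \<omega> in M. (\<lambda>N. P N \<omega>) \<longlonglongrightarrow> (\<Prod>i\<in>arrived t \<omega>. g (real_of_ereal (T i \<omega>)))"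
    using P_eq
  proof eventually_elim
    case (elim \<omega>)
    then have "(\<lambda>N. P N \<omega>) = (\<lambda>N. \<Prod>i\<in>arrived t \<omega>. gN N (real_of_ereal (T i \<omega>)))" by auto
    moreover have "(\<lambda>N. \<Prod>i\<in>arrived t \<omega>. gN N (real_of_ereal (T i \<omega>))) \<longlonglongrightarrow> (\<Prod>i\<in>arrived t \<omega>. g (real_of_ereal (T i \<omega>)))"
      by (intro tendsto_prod gN_conv)
    ultimately show ?case by simp
  qed
  note [measurable] = points_measurable
  show meas: ?meas by (rule arrived_prod_measurable) measurable
  have "(\<lambda>N. expectation (P N)) \<longlonglongrightarrow> expectation (\<lambda>\<omega>. \<Prod>i\<in>arrived t \<omega>. g (real_of_ereal (T i \<omega>)))"
  proof (rule integral_dominated_convergence[where w="\<lambda>_. 1"])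
    show "AE \<omega> in M. norm (P N \<omega>) \<le> 1" for N
    proof (rule AE_I2)
      fix \<omega>
      have "0 \<le> x N l ^ point_count T (A N l) \<omega> \<and> x N l ^ point_count T (A N l) \<omega> \<le> 1" if "l < Suc (Suc N)" for l
        using that by (auto simp: x_def intro!: power_le_one)
      then show "norm (P N \<omega>) \<le> 1" unfolding P_def by (auto simp: abs_prod intro!: prod_le_1 simp del: prod.lessThan_Suc)
    qed
  qed (use meas P_conv in auto)
  moreover have "expectation (P N) = exp (LINT \<tau>:{0..t}|lborel. lam \<tau> * (gN N \<tau> - 1))" for N
  proof -
    have A_sub: "A N l \<subseteq> {0..t}" for l by (auto simp: A_def)
    have A_int: "integrable lborel (\<lambda>\<tau>. indicator (A N l) \<tau> * lam \<tau>)" for l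
      using rate_set_integrable[OF t A_meas A_sub] by (simp add: set_integrable_def)
    have "expectation (P N) = exp (\<Sum>l<Suc (Suc N). (x N l - 1) * (LINT \<tau>:A N l|lborel. lam \<tau>))"
      unfolding P_def using A_ok
      by (intro laplace_functional_step) (auto simp: disjoint_family_on_def A_def x_def)
    also have "(\<Sum>l<Suc (Suc N). (x N l - 1) * (LINT \<tau>:A N l|lborel. lam \<tau>))
        = (LINT \<tau>|lborel. (\<Sum>l<Suc (Suc N). (x N l - 1) * (indicator (A N l) \<tau> * lam \<tau>)))"
      using A_int by (subst Bochner_Integration.integral_sum) (auto simp: set_lebesgue_integral_def)
    also have "\<dots> = (LINT \<tau>:{0..t}|lborel. lam \<tau> * (gN N \<tau> - 1))"
      unfolding set_lebesgue_integral_def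
    proof (rule Bochner_Integration.integral_cong)
      fix \<tau>
      have "(\<Sum>l<Suc (Suc N). (x N l - 1) * (indicator (A N l) \<tau> * lam \<tau>))
          = (\<Sum>l<Suc (Suc N). if l = \<kappa> N \<tau> then indicator {0..t} \<tau> * (lam \<tau> * (x N l - 1)) else 0)"
        by (intro sum.cong) (auto simp: A_def indicator_def)
      also have "\<dots> = indicator {0..t} \<tau> * (lam \<tau> * (gN N \<tau> - 1))"
        using \<kappa>_le[of N \<tau>] by (subst sum.delta) (auto simp: gN_def)
      finally show "(\<Sum>l<Suc (Suc N). (x N l - 1) * (indicator (A N l) \<tau> * lam \<tau>)) = indicator {0..t} \<tau> *\<^sub>R (lam \<tau> * (gN N \<tau> - 1))"
        by simp
    qed simp
    finally show ?thesis .
  qed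
  moreover have "(\<lambda>N. LINT \<tau>:{0..t}|lborel. lam \<tau> * (gN N \<tau> - 1)) \<longlonglongrightarrow> (LINT \<tau>:{0..t}|lborel. lam \<tau> * (g \<tau> - 1))"
    unfolding set_lebesgue_integral_def
  proof (rule integral_dominated_convergence[where w="\<lambda>\<tau>. indicator {0..t} \<tau> * lam \<tau>"])
    have int: "set_integrable lborel {0..t} (\<lambda>\<tau>. lam \<tau> * (h \<tau> - 1))"
      if [measurable]: "h \<in> borel_measurable borel" and "\<And>\<tau>. 0 \<le> h \<tau>" "\<And>\<tau>. h \<tau> \<le> 1" for h :: "real \<Rightarrow> real"
    proof (rule rate_bounded_set_integrable[OF t])
      show "\<bar>h \<tau> - 1\<bar> \<le> 1" for \<tau> using that(2,3)[of \<tau>] by linarith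
    qed (simp add: set_borel_measurable_def)
    show "(\<lambda>\<tau>. indicator {0..t} \<tau> *\<^sub>R (lam \<tau> * (g \<tau> - 1))) \<in> borel_measurable lborel"
      using int[OF g] g01 by (auto simp: set_integrable_def dest: borel_measurable_integrable)
    show "(\<lambda>\<tau>. indicator {0..t} \<tau> *\<^sub>R (lam \<tau> * (gN N \<tau> - 1))) \<in> borel_measurable lborel" for N
      using int[OF gN_meas] gN01 by (auto simp: set_integrable_def dest: borel_measurable_integrable)
    show "integrable lborel (\<lambda>\<tau>. indicator {0..t} \<tau> * lam \<tau>)"
      using rate_integrable[OF t] by (simp add: set_integrable_def)
    show "AE \<tau> in lborel. (\<lambda>N. indicator {0..t} \<tau> *\<^sub>R (lam \<tau> * (gN N \<tau> - 1))) \<longlonglongrightarrow> indicator {0..t} \<tau> *\<^sub>R (lam \<tau> * (g \<tau> - 1))"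
      by (intro AE_I2 tendsto_intros gN_conv)
    show "AE \<tau> in lborel. norm (indicator {0..t} \<tau> *\<^sub>R (lam \<tau> * (gN N \<tau> - 1))) \<le> indicator {0..t} \<tau> * lam \<tau>" for N
    proof (rule AE_I2)
      fix \<tau>
      show "norm (indicator {0..t} \<tau> *\<^sub>R (lam \<tau> * (gN N \<tau> - 1))) \<le> indicator {0..t} \<tau> * lam \<tau>"
        using rate_nonneg[of \<tau>] gN01[of N \<tau>] by (auto simp: indicator_def abs_mult intro!: mult_left_le)
    qed
  qed
  ultimately have "(\<lambda>N. exp (LINT \<tau>:{0..t}|lborel. lam \<tau> * (gN N \<tau> - 1))) \<longlonglongrightarrow> expectation (\<lambda>\<omega>. \<Prod>i\<in>arrived t \<omega>. g (real_of_ereal (T i \<omega>)))"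
    and "(\<lambda>N. exp (LINT \<tau>:{0..t}|lborel. lam \<tau> * (gN N \<tau> - 1))) \<longlonglongrightarrow> exp (LINT \<tau>:{0..t}|lborel. lam \<tau> * (g \<tau> - 1))"
    by (auto intro: tendsto_exp)
  then show "expectation (\<lambda>\<omega>. \<Prod>i\<in>arrived t \<omega>. g (real_of_ereal (T i \<omega>)))
       = exp (LINT \<tau>:{0..t}|lborel. lam \<tau> * (g \<tau> - 1))"
    by (rule LIMSEQ_unique)
qed

end

section \<open>Independent groups of sources\<close>

text \<open>
  Fubini's theorem in the form of a freezing rule: independence of two sigma-algebras says that
  \<open>\<omega> \<mapsto> (\<omega>, \<omega>)\<close> maps \<open>M\<close> to the product of its restrictions, so the two occurrences of \<open>\<omega>\<close> may be
  integrated separately. The joint measurability of \<open>f\<close> is what makes it applicable to a routing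
  process that is evaluated at a random age.
\<close>

lemma (in prob_space) expectation_indep_sigma_algebras:
  fixes f :: "'a \<Rightarrow> 'a \<Rightarrow> real"
  assumes ind: "indep_set (sets G) (sets H)" and sp: "space G = space M" "space H = space M"
    and f: "case_prod f \<in> borel_measurable (G \<Otimes>\<^sub>M H)"
    and b: "\<And>x y. \<bar>f x y\<bar> \<le> 1"
  shows "expectation (\<lambda>\<omega>. f \<omega> \<omega>) = expectation (\<lambda>x. expectation (\<lambda>y. f x y))"
proof -
  have sub: "sets G \<subseteq> events" "sets H \<subseteq> events" using indep_setD_ev1[OF ind] indep_setD_ev2[OF ind] .
  have rv [measurable]: "(\<lambda>x. x) \<in> measurable M G" "(\<lambda>x. x) \<in> measurable M H"
    using sub sp by (auto intro!: measurableI dest: sets.sets_into_space[of _ M])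
  have "{(\<lambda>x. x) -` A \<inter> space M | A. A \<in> sets K} = sets K" if "space K = space M" for K :: "'a measure"
  proof -
    have "A \<inter> space M = A" if "A \<in> sets K" for A
      using sets.sets_into_space[OF that] \<open>space K = space M\<close> by auto
    then have "(\<lambda>A. A \<inter> space M) ` sets K = (\<lambda>A. A) ` sets K" by (intro image_cong refl) auto
    then show ?thesis by (simp add: Setcompr_eq_image)
  qed
  then have "indep_var G (\<lambda>x. x) H (\<lambda>x. x)"
    unfolding indep_var_eq using ind sp rv sets.sigma_sets_eq[of G] sets.sigma_sets_eq[of H] by auto
  then have D: "distr M G (\<lambda>x. x) \<Otimes>\<^sub>M distr M H (\<lambda>x. x) = distr M (G \<Otimes>\<^sub>M H) (\<lambda>x. (x, x))"
    by (simp add: indep_var_distribution_eq)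
  interpret G: prob_space "distr M G (\<lambda>x. x)" by (rule prob_space_distr) fact
  interpret H: prob_space "distr M H (\<lambda>x. x)" by (rule prob_space_distr) fact
  interpret GH: pair_prob_space "distr M G (\<lambda>x. x)" "distr M H (\<lambda>x. x)" ..
  have f': "case_prod f \<in> borel_measurable (distr M G (\<lambda>x. x) \<Otimes>\<^sub>M distr M H (\<lambda>x. x))"
    using f by (simp cong: measurable_cong_sets)
  have int: "integrable (distr M G (\<lambda>x. x) \<Otimes>\<^sub>M distr M H (\<lambda>x. x)) (\<lambda>(x, y). f x y)"
    by (rule GH.P.integrable_const_bound[where B=1]) (use b f' in auto)
  have "expectation (\<lambda>\<omega>. f \<omega> \<omega>) = (LINT z|distr M (G \<Otimes>\<^sub>M H) (\<lambda>x. (x, x)). case_prod f z)"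
    using f by (subst integral_distr) auto
  also have "\<dots> = (LINT x|distr M G (\<lambda>x. x). LINT y|distr M H (\<lambda>x. x). f x y)"
    unfolding D[symmetric] using GH.integral_fst'[OF int] by simp
  also have "\<dots> = expectation (\<lambda>x. LINT y|distr M H (\<lambda>x. x). f x y)"
    using f' by (subst integral_distr) (auto intro!: H.borel_measurable_lebesgue_integral simp: rv cong: measurable_cong_sets)
  also have "\<dots> = expectation (\<lambda>x. expectation (\<lambda>y. f x y))"
  proof (rule Bochner_Integration.integral_cong)
    fix x assume "x \<in> space M"
    then have "f x \<in> borel_measurable H"
      using measurable_Pair2[OF f, of x] sp by simp
    then show "(LINT y|distr M H (\<lambda>x. x). f x y) = expectation (\<lambda>y. f x y)"
      by (subst integral_distr) auto
  qed simp
  finally show ?thesis .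
qed

context batch_arrival_network
begin

definition source_join :: "source set \<Rightarrow> 'a measure" where
  "source_join I = sigma (space M) (\<Union>a\<in>I. sets (source_algebra M T J B X a))"

lemma space_source_algebra [simp]: "space (source_algebra M T J B X a) = space M"
  by (cases a) auto

lemma space_source_join [simp]: "space (source_join I) = space M"
  by (simp add: source_join_def space_measure_of_conv)

lemma sets_source_join:
  "sets (source_join I) = sigma_sets (space M) (\<Union>a\<in>I. sets (source_algebra M T J B X a))"
  unfolding source_join_def
  using sets.sets_into_space[of _ "source_algebra M T J B X _"] by (intro sets_measure_of) auto

lemma sets_source_algebra_subset: "a \<in> I \<Longrightarrow> sets (source_algebra M T J B X a) \<subseteq> sets (source_join I)"
  unfolding sets_source_join by auto

lemma sets_source_join_mono: "I \<subseteq> I' \<Longrightarrow> sets (source_join I) \<subseteq> sets (source_join I')"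
  unfolding sets_source_join by (intro sigma_sets_mono') auto

lemma indep_source_joins:
  assumes "I \<subseteq> sources J" "I' \<subseteq> sources J" "I \<inter> I' = {}"
  shows "indep_set (sets (source_join I)) (sets (source_join I'))"
proof -
  have "indep_sets (\<lambda>b. sigma_sets (space M) (\<Union>a\<in>(case b of True \<Rightarrow> I | False \<Rightarrow> I'). sets (source_algebra M T J B X a))) UNIV"
  proof (rule indep_sets_collect_sigma)
    show "indep_sets (\<lambda>a. sets (source_algebra M T J B X a)) (\<Union>b. case b of True \<Rightarrow> I | False \<Rightarrow> I')"
      using assms by (intro indep_sets_mono_index[OF _ sources_indep]) (auto split: bool.splits)
    show "disjoint_family (case_bool I I')"
      using assms by (auto simp: disjoint_family_on_def split: bool.splits)
  qed (auto intro: sets.Int_stable)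
  moreover have "(\<lambda>b. sigma_sets (space M) (\<Union>a\<in>(case b of True \<Rightarrow> I | False \<Rightarrow> I'). sets (source_algebra M T J B X a)))
     = case_bool (sets (source_join I)) (sets (source_join I'))"
    by (auto simp: sets_source_join fun_eq_iff split: bool.splits)
  ultimately show ?thesis unfolding indep_set_def by simp
qed

lemma source_join_subset: "I \<subseteq> sources J \<Longrightarrow> sets (source_join I) \<subseteq> events"
  using indep_setD_ev1[OF indep_source_joins[of I "{}"]] by simp

lemma measurable_source_join:
  assumes "f \<in> measurable (source_join I) N" "I \<subseteq> sources J"
  shows "f \<in> measurable M N"
  using assms source_join_subset[of I] by (auto simp: measurable_def)

lemma expectation_source_joins:
  fixes f :: "'a \<Rightarrow> 'a \<Rightarrow> real"
  assumes "I \<subseteq> sources J" "I' \<subseteq> sources J" "I \<inter> I' = {}"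
    and "case_prod f \<in> borel_measurable (source_join I \<Otimes>\<^sub>M source_join I')"
    and "\<And>x y. \<bar>f x y\<bar> \<le> 1"
  shows "expectation (\<lambda>\<omega>. f \<omega> \<omega>) = expectation (\<lambda>x. expectation (\<lambda>y. f x y))"
  by (rule expectation_indep_sigma_algebras[OF indep_source_joins[OF assms(1-3)]])
     (use assms in auto)

lemma measurable_from_source_algebra:
  "f \<in> measurable (source_algebra M T J B X a) N \<Longrightarrow> a \<in> I \<Longrightarrow> f \<in> measurable (source_join I) N"
  using sets_source_algebra_subset[of a I] by (auto simp: measurable_def)

lemma points_source_measurable:
  assumes "Arrivals \<in> I"
  shows "T i \<in> borel_measurable (source_join I)"
proof (rule measurable_from_source_algebra[OF _ assms])
  have "(\<lambda>\<omega>. \<lambda>i\<in>UNIV. T i \<omega>) \<in> measurable (source_algebra M T J B X Arrivals) (\<Pi>\<^sub>M i\<in>UNIV. borel)"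
    by (simp, rule measurable_vimage_algebra1) (auto simp: space_PiM)
  from measurable_compose[OF this measurable_component_singleton[of i]]
  show "T i \<in> borel_measurable (source_algebra M T J B X Arrivals)" by simp
qed

lemma batch_source_measurable:
  assumes "Batch i \<in> I" "j \<in> {1..J}"
  shows "B i j \<in> measurable (source_join I) (count_space UNIV)"
proof (rule measurable_from_source_algebra[OF _ assms(1)])
  have "(\<lambda>\<omega>. \<lambda>j\<in>{1..J}. B i j \<omega>) \<in> measurable (source_algebra M T J B X (Batch i)) (batch_space J)"
    by (simp, rule measurable_vimage_algebra1) (auto simp: space_PiM batch_space_def)
  from measurable_compose[OF this[unfolded batch_space_def] measurable_component_singleton[of j]]
  show "B i j \<in> measurable (source_algebra M T J B X (Batch i)) (count_space UNIV)"
    using assms by simp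
qed

lemma routing_source_measurable:
  assumes "Customer j i l \<in> I" "j \<in> {1..J}"
  shows "(\<lambda>(s, \<omega>). X j i l s \<omega>) \<in> measurable (restrict_space borel {0..} \<Otimes>\<^sub>M source_join I) (count_space UNIV)"
proof -
  have "(\<lambda>z. z) \<in> measurable (restrict_space borel {0..} \<Otimes>\<^sub>M source_join I)
     (restrict_space borel {0..} \<Otimes>\<^sub>M source_algebra M T J B X (Customer j i l))"
    by (rule measurable_pair) (auto intro!: measurable_compose[OF measurable_snd] measurable_from_source_algebra[OF _ assms(1)] simp: comp_def simp del: source_algebra.simps)
  from measurable_compose[OF this routing_jointly_measurable[OF assms(2)]] show ?thesis .
qed

lemma routing_measurable_at:
  assumes "Customer j i l \<in> I" "j \<in> {1..J}" "0 \<le> s"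
  shows "X j i l s \<in> measurable (source_join I) (count_space UNIV)"
  using measurable_Pair2[OF routing_source_measurable[OF assms(1,2)], of s] assms(3)
  by (simp add: space_restrict_space)

definition batch_sources :: "nat \<Rightarrow> source set" where
  "batch_sources i = insert (Batch i) {Customer j i l | j l. j \<in> {1..J}}"

text \<open>
  The occupancy vector of batch \<open>i\<close> at age \<open>s\<close>. It is extensional on \<open>{1..J}\<close>, so that vectors can be
  compared by equality and range over finite product sets.
\<close>

definition occupancy :: "nat \<Rightarrow> real \<Rightarrow> 'a \<Rightarrow> nat \<Rightarrow> nat" where
  "occupancy i s \<omega> = (\<lambda>k\<in>{1..J}. \<Sum>j=1..J. \<Sum>l<B i j \<omega>. of_bool (X j i l s \<omega> = k))"

lemma occupancy_PiE [simp, intro]: "occupancy i s \<omega> \<in> (\<Pi>\<^sub>E k\<in>{1..J}. UNIV)"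
  by (simp add: occupancy_def)

text \<open>
  The number of summands \<open>B i j\<close> is random, but it takes countably many values, on each of which the
  sum has a fixed length.
\<close>

lemma occupancy_component_measurable:
  assumes k: "k \<in> {1..J}"
  shows "(\<lambda>(s, \<omega>). occupancy i s \<omega> k) \<in> measurable (restrict_space borel {0..} \<Otimes>\<^sub>M source_join (batch_sources i)) (count_space UNIV)"
proof -
  let ?N = "restrict_space borel {0..} \<Otimes>\<^sub>M source_join (batch_sources i)"
  have "(\<lambda>z. \<Sum>l<B i j (snd z). of_bool (X j i l (fst z) (snd z) = k) :: nat) \<in> measurable ?N (count_space UNIV)"
    if j: "j \<in> {1..J}" for j
  proof (rule measurable_compose_countable[where f="\<lambda>b z. \<Sum>l<b. of_bool (X j i l (fst z) (snd z) = k)"])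
    show "(\<lambda>z. B i j (snd z)) \<in> measurable ?N (count_space UNIV)"
      by (rule measurable_compose[OF measurable_snd batch_source_measurable]) (use j in \<open>auto simp: batch_sources_def\<close>)
    fix b
    have [measurable]: "(\<lambda>z. X j i l (fst z) (snd z)) \<in> measurable ?N (count_space UNIV)" for l
      using routing_source_measurable[of j i l "batch_sources i"] j by (auto simp: batch_sources_def case_prod_beta')
    show "(\<lambda>z. \<Sum>l<b. of_bool (X j i l (fst z) (snd z) = k) :: nat) \<in> measurable ?N (count_space UNIV)"
      by measurable
  qed
  then have "(\<lambda>z. \<Sum>j=1..J. \<Sum>l<B i j (snd z). of_bool (X j i l (fst z) (snd z) = k) :: nat) \<in> measurable ?N (count_space UNIV)"
    by (intro measurable_sum_nat) auto
  then show ?thesis using k by (simp add: occupancy_def case_prod_beta')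
qed

lemma occupancy_event_measurable:
  assumes "y \<in> (\<Pi>\<^sub>E k\<in>{1..J}. UNIV)"
  shows "Measurable.pred (restrict_space borel {0..} \<Otimes>\<^sub>M source_join (batch_sources i)) (\<lambda>(s, \<omega>). occupancy i s \<omega> = y)"
proof -
  have "(\<lambda>(s, \<omega>). occupancy i s \<omega> = y) = (\<lambda>z. \<forall>k\<in>{1..J}. (\<lambda>(s, \<omega>). occupancy i s \<omega> k) z = y k)"
    using PiE_ext[OF occupancy_PiE assms] by (fastforce simp: fun_eq_iff)
  moreover note occupancy_component_measurable[measurable]
  ultimately show ?thesis by simp
qed

end

section \<open>Occupancy vector of a single batch\<close>

context batch_arrival_network
begin

lemma batch_sources_subset: "batch_sources i \<subseteq> sources J"
  by (auto simp: batch_sources_def sources_def)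

lemma routing_source_algebra_measurable:
  assumes "j \<in> {1..J}" "0 \<le> s"
  shows "X j i l s \<in> measurable (source_algebra M T J B X (Customer j i l)) (count_space UNIV)"
  using measurable_Pair2[OF routing_jointly_measurable[OF assms(1)], of s] assms(2)
  by (simp add: space_restrict_space del: source_algebra.simps)

lemma expectation_routing_weight:
  assumes j: "j \<in> {1..J}" and s: "0 \<le> s"
  shows "expectation (\<lambda>\<omega>. if X j i l s \<omega> \<in> {1..J} then z (X j i l s \<omega>) else 1)
       = 1 - (\<Sum>k=1..J. (1 - z k) * q j k s)"
proof -
  note [measurable] = routing_measurable[OF j s]
  have int: "integrable M (\<lambda>\<omega>. of_bool (X j i l s \<omega> = k) :: real)" for k
    by (rule integrable_const_bound[where B=1]) auto
  have law: "expectation (\<lambda>\<omega>. of_bool (X j i l s \<omega> = k)) = q j k s" if k: "k \<in> {1..J}" for k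
  proof -
    have "expectation (\<lambda>\<omega>. of_bool (X j i l s \<omega> = k)) = expectation (indicat_real {\<omega> \<in> space M. X j i l s \<omega> = k})"
      by (intro Bochner_Integration.integral_cong) (auto simp: indicator_def)
    then show ?thesis using routing_law[OF j k s, of i l] by simp
  qed
  have "(if x \<in> {1..J} then z x else 1) = 1 - (\<Sum>k=1..J. (1 - z k) * of_bool (x = k))" for x
  proof -
    have "(\<Sum>k=1..J. (1 - z k) * of_bool (x = k)) = (\<Sum>k=1..J. if k = x then 1 - z k else 0)"
      by (intro sum.cong) auto
    then show ?thesis by (simp add: sum.delta)
  qed
  then have "expectation (\<lambda>\<omega>. if X j i l s \<omega> \<in> {1..J} then z (X j i l s \<omega>) else 1)
      = expectation (\<lambda>\<omega>. 1 - (\<Sum>k=1..J. (1 - z k) * of_bool (X j i l s \<omega> = k)))"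
    by simp
  also have "\<dots> = 1 - (\<Sum>k=1..J. (1 - z k) * expectation (\<lambda>\<omega>. of_bool (X j i l s \<omega> = k)))"
  proof -
    have "integrable M (\<lambda>\<omega>. (1 - z k) * of_bool (X j i l s \<omega> = k))" for k
      by (rule integrable_mult_right[OF int])
    then show ?thesis
      using int by (simp add: Bochner_Integration.integral_diff Bochner_Integration.integral_sum prob_space
          del: sum_mult_of_bool_eq)
  qed
  also have "\<dots> = 1 - (\<Sum>k=1..J. (1 - z k) * q j k s)"
    using law by (intro arg_cong[where f="\<lambda>x. 1 - x"] sum.cong) auto
  finally show ?thesis .
qed

text \<open>
  The lengths \<open>b j\<close> are constants here. They are the batch sizes after these have been frozen.
\<close>

lemma expectation_routing_product:
  fixes b :: "nat \<Rightarrow> nat" and \<zeta> :: "nat \<Rightarrow> real"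
  assumes s: "0 \<le> s" and \<zeta>: "\<And>x. 0 \<le> \<zeta> x" "\<And>x. \<zeta> x \<le> 1"
  shows "expectation (\<lambda>\<omega>. \<Prod>j=1..J. \<Prod>l<b j. \<zeta> (X j i l s \<omega>))
       = (\<Prod>j=1..J. \<Prod>l<b j. expectation (\<lambda>\<omega>. \<zeta> (X j i l s \<omega>)))"
proof -
  define I where "I = (\<lambda>(j, l). Customer j i l) ` (SIGMA j:{1..J}. {..<b j})"
  define Y where "Y a \<omega> = (case a of Customer j i l \<Rightarrow> \<zeta> (X j i l s \<omega>) | _ \<Rightarrow> 1)" for a \<omega>
  have Y_Customer: "Y (Customer j i l) = (\<lambda>\<omega>. \<zeta> (X j i l s \<omega>))" for j l
    by (simp add: Y_def fun_eq_iff)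
  have inj: "inj_on (\<lambda>(j, l). Customer j i l) (SIGMA j:{1..J}. {..<b j})"
    by (auto simp: inj_on_def)
  have Ym: "Y a \<in> borel_measurable (source_algebra M T J B X a)" if aI: "a \<in> I" for a
  proof -
    obtain j l where a: "a = Customer j i l" "j \<in> {1..J}" using aI by (auto simp: I_def)
    show ?thesis
      unfolding a Y_def using measurable_compose[OF routing_source_algebra_measurable[OF a(2) s], of \<zeta> borel i l]
      by (simp del: source_algebra.simps)
  qed
  have Isub: "I \<subseteq> sources J" by (auto simp: I_def sources_def)
  have Ym': "Y a \<in> borel_measurable M" if "a \<in> I" for a
    using Ym[OF that] Isub that
    by (intro measurable_source_join[OF measurable_from_source_algebra[of _ a]]) auto
  have ind: "indep_vars (\<lambda>_. borel) Y I"
    unfolding indep_vars_def2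
  proof (intro conjI ballI)
    show "Y a \<in> borel_measurable M" if "a \<in> I" for a by (rule Ym'[OF that])
    show "indep_sets (\<lambda>a. {Y a -` A \<inter> space M |A. A \<in> sets borel}) I"
    proof (rule indep_sets_mono[OF sources_indep Isub])
      fix a assume "a \<in> I"
      then show "{Y a -` A \<inter> space M |A. A \<in> sets borel} \<subseteq> sets (source_algebra M T J B X a)"
        using measurable_sets[OF Ym] by (auto simp del: source_algebra.simps)
    qed
  qed
  have "expectation (\<lambda>\<omega>. \<Prod>a\<in>I. Y a \<omega>) = (\<Prod>a\<in>I. expectation (Y a))"
  proof (rule indep_vars_lebesgue_integral[OF _ ind])
    show "finite I" by (simp add: I_def)
    show "integrable M (Y a)" if "a \<in> I" for a
      by (rule integrable_const_bound[where B=1]) (use Ym'[OF that] \<zeta> in \<open>auto simp: Y_def split: source.splits\<close>)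
  qed
  then show ?thesis
    unfolding I_def prod.reindex[OF inj] by (simp add: Y_Customer prod.Sigma case_prod_beta')
qed

text \<open>
  Each customer contributes the factor of the queue that it occupies, or \<open>1\<close> if it has left.
\<close>

lemma occupancy_power_prod:
  "(\<Prod>k=1..J. z k ^ occupancy i s \<omega> k) =
   (\<Prod>j=1..J. \<Prod>l<B i j \<omega>. if X j i l s \<omega> \<in> {1..J} then z (X j i l s \<omega>) else 1 :: real)"
proof -
  have single: "(\<Prod>k=1..J. z k ^ of_bool (x = k)) = (if x \<in> {1..J} then z x else 1)" for x
  proof -
    have "(\<Prod>k=1..J. z k ^ of_bool (x = k)) = (\<Prod>k=1..J. if k = x then z k else 1)"
      by (intro prod.cong) auto
    then show ?thesis by (simp add: prod.delta)
  qed
  have "(\<Prod>k=1..J. z k ^ occupancy i s \<omega> k) = (\<Prod>k=1..J. \<Prod>j=1..J. \<Prod>l<B i j \<omega>. z k ^ of_bool (X j i l s \<omega> = k))"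
    by (intro prod.cong refl) (simp only: occupancy_def power_sum restrict_apply' if_True)
  also have "\<dots> = (\<Prod>j=1..J. \<Prod>k=1..J. \<Prod>l<B i j \<omega>. z k ^ of_bool (X j i l s \<omega> = k))"
    by (rule prod.swap)
  also have "\<dots> = (\<Prod>j=1..J. \<Prod>l<B i j \<omega>. \<Prod>k=1..J. z k ^ of_bool (X j i l s \<omega> = k))"
    by (intro prod.cong refl prod.swap)
  finally show ?thesis unfolding single .
qed

text \<open>
  Freezing the batch sizes turns each customer that entered queue \<open>j\<close> into the factor
  \<open>w j = 1 - \<Sum>k. (1 - z k) q j k s\<close>, and the generating function of the batch vector is then evaluated
  at \<open>w\<close>; the entry probabilities \<open>p\<close> average \<open>q\<close> into \<open>queue_prob\<close>.
\<close>

lemma occupancy_pgf: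
  assumes s: "0 \<le> s" and z: "\<And>k. k \<in> {1..J} \<Longrightarrow> 0 \<le> z k \<and> z k \<le> 1"
  shows "expectation (\<lambda>\<omega>. \<Prod>k=1..J. z k ^ occupancy i s \<omega> k)
       = pgf S (1 - (\<Sum>k=1..J. (1 - z k) * queue_prob J p q k s))"
proof -
  define \<zeta> where "\<zeta> x = (if x \<in> {1..J} then z x else 1)" for x :: nat
  have \<zeta>01: "0 \<le> \<zeta> x" "\<zeta> x \<le> 1" for x using z by (auto simp: \<zeta>_def)
  define w where "w j = 1 - (\<Sum>k=1..J. (1 - z k) * q j k s)" for j
  define C where "C = {Customer j i l | j l. j \<in> {1..J}}"
  have Ew: "expectation (\<lambda>\<omega>. \<zeta> (X j i l s \<omega>)) = w j" if "j \<in> {1..J}" for j l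
    unfolding \<zeta>_def w_def by (rule expectation_routing_weight[OF that s])
  have w01: "w j \<in> {0..1}" if j: "j \<in> {1..J}" for j
  proof -
    note [measurable] = routing_measurable[OF j s]
    have "integrable M (\<lambda>\<omega>. \<zeta> (X j i 0 s \<omega>))"
      by (rule integrable_const_bound[where B=1]) (use \<zeta>01 in auto)
    then have "expectation (\<lambda>\<omega>. \<zeta> (X j i 0 s \<omega>)) \<le> expectation (\<lambda>_. 1)"
      using \<zeta>01 by (intro integral_mono) auto
    moreover have "0 \<le> expectation (\<lambda>\<omega>. \<zeta> (X j i 0 s \<omega>))"
      using \<zeta>01 by (intro Bochner_Integration.integral_nonneg) auto
    ultimately show ?thesis using Ew[OF j] by (simp add: prob_space)
  qed
  have "expectation (\<lambda>\<omega>. \<Prod>k=1..J. z k ^ occupancy i s \<omega> k)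
      = expectation (\<lambda>\<omega>. \<Prod>j=1..J. \<Prod>l<B i j \<omega>. \<zeta> (X j i l s \<omega>))"
    unfolding occupancy_power_prod \<zeta>_def ..
  also have "\<dots> = expectation (\<lambda>x. expectation (\<lambda>y. \<Prod>j=1..J. \<Prod>l<B i j x. \<zeta> (X j i l s y)))"
  proof (rule expectation_source_joins[of "{Batch i}" C])
    let ?N = "source_join {Batch i} \<Otimes>\<^sub>M source_join C"
    have "(\<lambda>z. \<Prod>l<B i j (fst z). \<zeta> (X j i l s (snd z))) \<in> borel_measurable ?N" if j: "j \<in> {1..J}" for j
    proof (rule measurable_compose_countable[where f="\<lambda>b z. \<Prod>l<b. \<zeta> (X j i l s (snd z))"])
      show "(\<lambda>z. B i j (fst z)) \<in> measurable ?N (count_space UNIV)"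
        by (rule measurable_compose[OF measurable_fst batch_source_measurable]) (use j in auto)
      have [measurable]: "X j i l s \<in> measurable (source_join C) (count_space UNIV)" for l
        using j s by (intro routing_measurable_at) (auto simp: C_def)
      show "(\<lambda>z. \<Prod>l<b. \<zeta> (X j i l s (snd z))) \<in> borel_measurable ?N" for b
        by measurable
    qed
    then show "(\<lambda>(x, y). \<Prod>j=1..J. \<Prod>l<B i j x. \<zeta> (X j i l s y)) \<in> borel_measurable ?N"
      unfolding case_prod_beta' by (intro borel_measurable_prod) auto
    show "\<bar>\<Prod>j=1..J. \<Prod>l<B i j x. \<zeta> (X j i l s y)\<bar> \<le> 1" for x y
      using \<zeta>01 by (simp add: abs_prod) (intro prod_le_1 conjI prod_nonneg; simp)
  qed (auto simp: C_def sources_def)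
  also have "\<dots> = expectation (\<lambda>x. \<Prod>j=1..J. w j ^ B i j x)"
  proof (intro Bochner_Integration.integral_cong refl)
    fix x
    have "expectation (\<lambda>y. \<Prod>j=1..J. \<Prod>l<B i j x. \<zeta> (X j i l s y)) = (\<Prod>j=1..J. \<Prod>l<B i j x. w j)"
      unfolding expectation_routing_product[where i=i and \<zeta>=\<zeta> and b="\<lambda>j. B i j x", OF s \<zeta>01]
      by (intro prod.cong refl Ew)
    then show "expectation (\<lambda>y. \<Prod>j=1..J. \<Prod>l<B i j x. \<zeta> (X j i l s y)) = (\<Prod>j=1..J. w j ^ B i j x)"
      by simp
  qed
  also have "\<dots> = (LINT c|distr M (batch_space J) (\<lambda>\<omega>. \<lambda>j\<in>{1..J}. B i j \<omega>). (\<Prod>j=1..J. w j ^ c j))"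
  proof (subst integral_distr)
    show "(\<lambda>\<omega>. \<lambda>j\<in>{1..J}. B i j \<omega>) \<in> measurable M (batch_space J)"
      unfolding batch_space_def by (intro measurable_restrict batch_measurable)
    have "(\<lambda>c. c j) \<in> measurable (batch_space J) (count_space UNIV)" if "j \<in> {1..J}" for j
      unfolding batch_space_def using that by (rule measurable_component_singleton)
    then show "(\<lambda>c. \<Prod>j=1..J. w j ^ c j) \<in> borel_measurable (batch_space J)"
      by (intro borel_measurable_prod) (auto intro: measurable_compose[where g="\<lambda>n. _ ^ n"])
  qed (auto intro!: Bochner_Integration.integral_cong prod.cong)
  also have "\<dots> = pgf S (\<Sum>j=1..J. p j * w j)"
    unfolding batch_law by (rule batch_pgf) (rule w01)
  also have "(\<Sum>j=1..J. p j * w j) = 1 - (\<Sum>k=1..J. (1 - z k) * queue_prob J p q k s)"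
  proof -
    have "(\<Sum>j=1..J. p j * w j) = (\<Sum>j=1..J. p j) - (\<Sum>j=1..J. \<Sum>k=1..J. p j * ((1 - z k) * q j k s))"
      by (simp add: w_def right_diff_distrib sum_subtractf sum_distrib_left)
    also have "(\<Sum>j=1..J. \<Sum>k=1..J. p j * ((1 - z k) * q j k s)) = (\<Sum>k=1..J. (1 - z k) * queue_prob J p q k s)"
      by (subst sum.swap) (simp add: queue_prob_def sum_distrib_left mult_ac)
    finally show ?thesis using entry_sum by simp
  qed
  finally show ?thesis .
qed

lemma queue_prob_nonneg:
  assumes s: "0 \<le> s" and k: "k \<in> {1..J}"
  shows "0 \<le> queue_prob J p q k s"
proof -
  have "0 \<le> q j k s" if "j \<in> {1..J}" for j
    using routing_law[OF that k s, of undefined undefined] measure_nonneg by metis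
  then show ?thesis unfolding queue_prob_def using entry_nonneg by (intro sum_nonneg) auto
qed

lemma queue_prob_sum_le_one:
  assumes s: "0 \<le> s"
  shows "(\<Sum>k=1..J. queue_prob J p q k s) \<le> 1"
proof -
  have "(\<Sum>k=1..J. q j k s) \<le> 1" if j: "j \<in> {1..J}" for j
  proof -
    have "0 \<le> expectation (\<lambda>\<omega>. if X j 0 0 s \<omega> \<in> {1..J} then 0 else 1 :: real)"
      by (intro Bochner_Integration.integral_nonneg) auto
    then show ?thesis unfolding expectation_routing_weight[OF j s, where z="\<lambda>_. 0"] by simp
  qed
  then have "(\<Sum>j=1..J. p j * (\<Sum>k=1..J. q j k s)) \<le> (\<Sum>j=1..J. p j * 1)"
    using entry_nonneg by (intro sum_mono mult_left_mono) auto
  then show ?thesis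
    unfolding queue_prob_def by (subst sum.swap) (simp add: sum_distrib_left entry_sum[simplified])
qed

lemma occupancy_age_measurable:
  assumes "y \<in> (\<Pi>\<^sub>E k\<in>{1..J}. UNIV)" "batch_sources i \<subseteq> I"
  shows "Measurable.pred (borel \<Otimes>\<^sub>M source_join I) (\<lambda>(\<tau>, \<omega>). occupancy i (max 0 (t - \<tau>)) \<omega> = y)"
proof -
  have "(\<lambda>z. (max 0 (t - fst z), snd z)) \<in> measurable (borel \<Otimes>\<^sub>M source_join I) (restrict_space borel {0..} \<Otimes>\<^sub>M source_join (batch_sources i))"
  proof (rule measurable_Pair)
    show "(\<lambda>z. max 0 (t - fst z)) \<in> measurable (borel \<Otimes>\<^sub>M source_join I) (restrict_space borel {0..})"
      by (intro measurable_restrict_space2) auto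
    have "(\<lambda>x. x) \<in> measurable (source_join I) (source_join (batch_sources i))"
      using sets_source_join_mono[OF assms(2)] by (auto intro!: measurableI dest: sets.sets_into_space[of _ "source_join _"])
    then show "snd \<in> measurable (borel \<Otimes>\<^sub>M source_join I) (source_join (batch_sources i))"
      by (rule measurable_compose[OF measurable_snd])
  qed
  from measurable_compose[OF this occupancy_event_measurable[OF assms(1)]]
  show ?thesis by (simp add: case_prod_beta')
qed

end

section \<open>Weighted products over the arrived batches\<close>

context batch_arrival_network
begin

text \<open>
  The batches are integrated out one at a time. When batch \<open>k\<close> is treated, the sources \<open>I k\<close> (the
  arrival times and the earlier batches) are independent of those of batch \<open>k\<close>, so its factor \<open>h k\<close> may
  be replaced by the function \<open>g' k\<close> of the arrival times alone, which joins the remaining weight \<open>R\<close>.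
  What is left is the generating functional of the Poisson points. Ages are written as
  \<open>max 0 (t - \<tau>)\<close>, which agrees with \<open>t - \<tau>\<close> for arrived batches and is admissible for all \<open>\<tau>\<close>.
\<close>

lemma weighted_arrivals_functional:
  fixes f :: "real \<Rightarrow> (nat \<Rightarrow> nat) \<Rightarrow> real"
  assumes t: "0 \<le> t" and F: "finite F" "F \<subseteq> (\<Pi>\<^sub>E k\<in>{1..J}. UNIV)"
    and u: "\<And>y. y \<in> F \<Longrightarrow> 0 \<le> u y \<and> u y \<le> 1"
    and f: "\<And>i s y. 0 \<le> s \<Longrightarrow> y \<in> F \<Longrightarrow> expectation (\<lambda>\<omega>. of_bool (occupancy i s \<omega> = y)) = f s y"
  shows "expectation (\<lambda>\<omega>. \<Prod>i\<in>arrived t \<omega>. \<Sum>y\<in>F. u y * of_bool (occupancy i (max 0 (t - real_of_ereal (T i \<omega>))) \<omega> = y))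
       = exp (LINT \<tau>:{0..t}|lborel. lam \<tau> * ((\<Sum>y\<in>F. u y * f (t - \<tau>) y) - 1))" (is "_ = ?rhs")
proof -
  define W where "W i \<tau> \<omega> = (\<Sum>y\<in>F. u y * of_bool (occupancy i (max 0 (t - \<tau>)) \<omega> = y))" for i \<tau> \<omega>
  define g where "g \<tau> = (\<Sum>y\<in>F. u y * f (max 0 (t - \<tau>)) y)" for \<tau>
  have W_if: "W i \<tau> \<omega> = (if occupancy i (max 0 (t - \<tau>)) \<omega> \<in> F then u (occupancy i (max 0 (t - \<tau>)) \<omega>) else 0)" for i \<tau> \<omega>
  proof -
    have "W i \<tau> \<omega> = (\<Sum>y\<in>F. if y = occupancy i (max 0 (t - \<tau>)) \<omega> then u y else 0)"
      unfolding W_def by (intro sum.cong) auto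
    then show ?thesis using F(1) by (simp add: sum.delta)
  qed
  have W01: "0 \<le> W i \<tau> \<omega>" "W i \<tau> \<omega> \<le> 1" for i \<tau> \<omega>
    using u by (auto simp: W_if)
  have W_meas: "(\<lambda>z. W i (fst z) (snd z)) \<in> borel_measurable (borel \<Otimes>\<^sub>M source_join I)"
    if "batch_sources i \<subseteq> I" for i I
  proof -
    have "(\<lambda>z. u y * of_bool (occupancy i (max 0 (t - fst z)) (snd z) = y)) \<in> borel_measurable (borel \<Otimes>\<^sub>M source_join I)"
      if "y \<in> F" for y
    proof -
      have [measurable]: "Measurable.pred (borel \<Otimes>\<^sub>M source_join I) (\<lambda>z. occupancy i (max 0 (t - fst z)) (snd z) = y)"
        using occupancy_age_measurable[of y i I t] that F(2) \<open>batch_sources i \<subseteq> I\<close> by (auto simp: case_prod_beta')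
      show ?thesis by measurable
    qed
    then show ?thesis unfolding W_def by (intro borel_measurable_sum)
  qed
  have W_meas_M: "(\<lambda>z. W i (fst z) (snd z)) \<in> borel_measurable (borel \<Otimes>\<^sub>M M)" for i
  proof -
    have "(\<lambda>z. z) \<in> measurable (borel \<Otimes>\<^sub>M M) (borel \<Otimes>\<^sub>M source_join (batch_sources i))"
      using measurable_source_join[of "\<lambda>x. x" "batch_sources i" "source_join (batch_sources i)"] batch_sources_subset
      by (intro measurable_pair) (auto simp: comp_def intro: measurable_compose[OF measurable_snd])
    from measurable_compose[OF this W_meas[OF order_refl]] show ?thesis .
  qed
  have W_meas_at: "W i \<tau> \<in> borel_measurable M" for i \<tau>
    using measurable_Pair2[OF W_meas_M, of \<tau> i] by simp
  have EW: "expectation (W i \<tau>) = g \<tau>" for i \<tau>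
  proof -
    have "integrable M (\<lambda>\<omega>. of_bool (occupancy i (max 0 (t - \<tau>)) \<omega> = y) :: real)" if "y \<in> F" for y
    proof (rule integrable_const_bound[where B=1])
      have "Measurable.pred (borel \<Otimes>\<^sub>M source_join (batch_sources i)) (\<lambda>(\<tau>, \<omega>). occupancy i (max 0 (t - \<tau>)) \<omega> = y)"
        using that F(2) by (intro occupancy_age_measurable) auto
      from measurable_Pair2[OF this, of \<tau>]
      have [measurable]: "Measurable.pred M (\<lambda>\<omega>. occupancy i (max 0 (t - \<tau>)) \<omega> = y)"
        using batch_sources_subset by (intro measurable_source_join[where I="batch_sources i"]) auto
      show "(\<lambda>\<omega>. of_bool (occupancy i (max 0 (t - \<tau>)) \<omega> = y) :: real) \<in> borel_measurable M" by measurable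
    qed auto
    then have "expectation (W i \<tau>) = (\<Sum>y\<in>F. u y * expectation (\<lambda>\<omega>. of_bool (occupancy i (max 0 (t - \<tau>)) \<omega> = y)))"
      unfolding W_def by (subst Bochner_Integration.integral_sum) auto
    then show ?thesis unfolding g_def using f by (auto intro: sum.cong)
  qed
  have g_meas [measurable]: "g \<in> borel_measurable borel"
  proof -
    have "(\<lambda>\<tau>. expectation (W 0 \<tau>)) \<in> borel_measurable borel"
      using W_meas_M[of 0] by (intro borel_measurable_lebesgue_integral) (simp add: case_prod_beta')
    then show ?thesis unfolding EW .
  qed
  have g01: "0 \<le> g \<tau>" "g \<tau> \<le> 1" for \<tau>
  proof -
    show "0 \<le> g \<tau>" unfolding EW[of 0, symmetric] using W01 by (intro Bochner_Integration.integral_nonneg) auto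
    have "integrable M (W 0 \<tau>)"
      by (rule integrable_const_bound[where B=1]) (use W01 W_meas_at in auto)
    then have "expectation (W 0 \<tau>) \<le> expectation (\<lambda>_. 1)"
      using W01 by (intro integral_mono) auto
    then show "g \<tau> \<le> 1" unfolding EW by (simp add: prob_space)
  qed
  note [measurable] = points_measurable
  define h where "h i \<omega> = (if T i \<omega> \<le> ereal t then W i (real_of_ereal (T i \<omega>)) \<omega> else 1)" for i \<omega>
  define g' where "g' i \<omega> = (if T i \<omega> \<le> ereal t then g (real_of_ereal (T i \<omega>)) else 1)" for i \<omega>
  have h01: "0 \<le> h i \<omega>" "h i \<omega> \<le> 1" for i \<omega> using W01 by (auto simp: h_def)
  have g'01: "0 \<le> g' i \<omega>" "g' i \<omega> \<le> 1" for i \<omega> using g01 by (auto simp: g'_def)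
  have h_meas: "h i \<in> borel_measurable (source_join I)" if I: "Arrivals \<in> I" "batch_sources i \<subseteq> I" for i I
  proof -
    have T_meas [measurable]: "T i \<in> borel_measurable (source_join I)"
      using I by (intro points_source_measurable)
    have "(\<lambda>\<omega>. (real_of_ereal (T i \<omega>), \<omega>)) \<in> measurable (source_join I) (borel \<Otimes>\<^sub>M source_join I)"
      by measurable
    from measurable_compose[OF this W_meas[OF I(2)]]
    have [measurable]: "(\<lambda>\<omega>. W i (real_of_ereal (T i \<omega>)) \<omega>) \<in> borel_measurable (source_join I)" by simp
    show ?thesis unfolding h_def by measurable
  qed
  define I where "I k = insert Arrivals (\<Union>i<k. batch_sources i)" for k :: nat
  have I_sub: "I k \<subseteq> sources J" for k
  proof -
    have "Arrivals \<in> sources J" by (simp add: sources_def)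
    then show ?thesis unfolding I_def using batch_sources_subset by blast
  qed
  have swap: "expectation (\<lambda>\<omega>. (\<Prod>i<k. h i \<omega>) * R \<omega>) = expectation (\<lambda>\<omega>. (\<Prod>i<k. g' i \<omega>) * R \<omega>)"
    if "R \<in> borel_measurable (source_join {Arrivals})" "\<And>\<omega>. 0 \<le> R \<omega>" "\<And>\<omega>. R \<omega> \<le> 1" for k R
    using that
  proof (induction k arbitrary: R)
    case 0
    then show ?case by simp
  next
    case (Suc k)
    have R_meas: "R \<in> borel_measurable (source_join (I k))"
      using Suc.prems(1) sets_source_join_mono[of "{Arrivals}" "I k"]
      by (auto simp: measurable_def I_def)
    define \<Phi> where "\<Phi> x y = (\<Prod>i<k. h i x) * R x * (if T k x \<le> ereal t then W k (real_of_ereal (T k x)) y else 1)" for x y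
    have prod01: "0 \<le> (\<Prod>i<k. h i x) * R x" "(\<Prod>i<k. h i x) * R x \<le> 1" for x
      using h01 Suc.prems by (auto intro!: mult_le_one prod_le_1 prod_nonneg mult_nonneg_nonneg)
    have "expectation (\<lambda>\<omega>. (\<Prod>i<Suc k. h i \<omega>) * R \<omega>) = expectation (\<lambda>\<omega>. \<Phi> \<omega> \<omega>)"
      by (simp add: \<Phi>_def h_def mult_ac)
    also have "\<dots> = expectation (\<lambda>x. expectation (\<lambda>y. \<Phi> x y))"
    proof (rule expectation_source_joins[OF I_sub[of k] batch_sources_subset[of k]])
      show "I k \<inter> batch_sources k = {}"
        by (auto simp: I_def batch_sources_def)
      have [measurable]: "T k \<in> borel_measurable (source_join (I k))"
        by (rule points_source_measurable) (simp add: I_def)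
      have [measurable]: "h i \<in> borel_measurable (source_join (I k))" if "i < k" for i
        using that by (intro h_meas) (auto simp: I_def)
      have 1: "(\<lambda>x. (\<Prod>i<k. h i x) * R x) \<in> borel_measurable (source_join (I k))"
        using R_meas by (intro borel_measurable_times borel_measurable_prod) auto
      have "(\<lambda>z. (real_of_ereal (T k (fst z)), snd z)) \<in> measurable (source_join (I k) \<Otimes>\<^sub>M source_join (batch_sources k)) (borel \<Otimes>\<^sub>M source_join (batch_sources k))"
        by measurable
      from measurable_compose[OF this W_meas[OF order_refl]]
      have [measurable]: "(\<lambda>z. W k (real_of_ereal (T k (fst z))) (snd z)) \<in> borel_measurable (source_join (I k) \<Otimes>\<^sub>M source_join (batch_sources k))" by simp
      have 2: "(\<lambda>z. if T k (fst z) \<le> ereal t then W k (real_of_ereal (T k (fst z))) (snd z) else 1)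
          \<in> borel_measurable (source_join (I k) \<Otimes>\<^sub>M source_join (batch_sources k))" by measurable
      show "case_prod \<Phi> \<in> borel_measurable (source_join (I k) \<Otimes>\<^sub>M source_join (batch_sources k))"
        unfolding \<Phi>_def case_prod_beta' by (rule borel_measurable_times[OF measurable_compose[OF measurable_fst 1] 2])
      have "0 \<le> \<Phi> x y" "\<Phi> x y \<le> 1" for x y
        unfolding \<Phi>_def using W01 by (auto intro!: mult_nonneg_nonneg[OF prod01(1)] mult_le_one[OF prod01(2)] prod01)
      then show "\<bar>\<Phi> x y\<bar> \<le> 1" for x y by (simp add: abs_le_iff order_trans[of _ 0])
    qed
    also have "\<dots> = expectation (\<lambda>x. (\<Prod>i<k. h i x) * (R x * g' k x))"
      unfolding \<Phi>_def by (intro Bochner_Integration.integral_cong refl) (simp add: g'_def EW prob_space)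
    also have "\<dots> = expectation (\<lambda>x. (\<Prod>i<k. g' i x) * (R x * g' k x))"
    proof (rule Suc.IH)
      have [measurable]: "T k \<in> borel_measurable (source_join {Arrivals})"
        by (rule points_source_measurable) simp
      show "(\<lambda>x. R x * g' k x) \<in> borel_measurable (source_join {Arrivals})"
        unfolding g'_def using Suc.prems(1) by measurable
    qed (use Suc.prems g'01 in \<open>auto intro: mult_le_one\<close>)
    finally show ?case by (simp add: mult_ac)
  qed
  have h_lim_meas: "(\<lambda>\<omega>. W i (real_of_ereal (T i \<omega>)) \<omega>) \<in> borel_measurable M" for i
  proof -
    have "(\<lambda>\<omega>. (real_of_ereal (T i \<omega>), \<omega>)) \<in> measurable M (borel \<Otimes>\<^sub>M M)" by measurable
    from measurable_compose[OF this W_meas_M[of i]] show ?thesis by simp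
  qed
  have "(\<lambda>m. expectation (\<lambda>\<omega>. \<Prod>i<m. h i \<omega>)) \<longlonglongrightarrow> expectation (\<lambda>\<omega>. \<Prod>i\<in>arrived t \<omega>. W i (real_of_ereal (T i \<omega>)) \<omega>)"
    unfolding h_def using h_lim_meas W01 by (rule arrived_prod_limit)
  moreover have "(\<lambda>m. expectation (\<lambda>\<omega>. \<Prod>i<m. g' i \<omega>)) \<longlonglongrightarrow> expectation (\<lambda>\<omega>. \<Prod>i\<in>arrived t \<omega>. g (real_of_ereal (T i \<omega>)))"
    unfolding g'_def using g01 by (intro arrived_prod_limit) auto
  moreover have "expectation (\<lambda>\<omega>. \<Prod>i<m. h i \<omega>) = expectation (\<lambda>\<omega>. \<Prod>i<m. g' i \<omega>)" for m
    using swap[of "\<lambda>_. 1" m] by simp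
  ultimately have "expectation (\<lambda>\<omega>. \<Prod>i\<in>arrived t \<omega>. W i (real_of_ereal (T i \<omega>)) \<omega>)
      = expectation (\<lambda>\<omega>. \<Prod>i\<in>arrived t \<omega>. g (real_of_ereal (T i \<omega>)))"
    by (auto intro: LIMSEQ_unique)
  also have "\<dots> = exp (LINT \<tau>:{0..t}|lborel. lam \<tau> * (g \<tau> - 1))"
    by (rule laplace_functional(1)[OF t g_meas g01])
  also have "\<dots> = ?rhs"
    unfolding g_def by (intro arg_cong[where f=exp] set_lebesgue_integral_cong) auto
  finally show ?thesis unfolding W_def .
qed

end

section \<open>Negative multinomial occupancy law\<close>

text \<open>
  Newton's binomial series for the exponent \<open>-s\<close>, with its coefficients in terms of the gamma function.
\<close>

lemma negative_binomial_series:
  fixes a b s x :: real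
  assumes s: "0 < s" and x: "0 \<le> b * x" "b * x < a"
  shows "(\<lambda>c. Gamma (s + real c) / (Gamma s * fact c) * b ^ c / a powr (s + real c) * x ^ c)
           sums (1 / (a - b * x) powr s)"
proof -
  have "(\<lambda>c. (- s gchoose c) * a powr (- s - real c) * (- (b * x)) ^ c) sums (a + - (b * x)) powr (- s)"
    using x by (intro gen_binomial_real'') auto
  moreover have "(- s gchoose c) * a powr (- s - real c) * (- (b * x)) ^ c
      = Gamma (s + real c) / (Gamma s * fact c) * b ^ c / a powr (s + real c) * x ^ c" for c
  proof -
    have "s \<notin> \<int>\<^sub>\<le>\<^sub>0" using s by auto
    then have "(- s gchoose c) = (- 1) ^ c * (Gamma (s + real c) / Gamma s) / fact c"
      by (simp add: gbinomial_pochhammer pochhammer_Gamma)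
    moreover have "(- (b * x)) ^ c = (- 1) ^ c * (b ^ c * x ^ c)"
      by (metis mult_minus1 power_mult_distrib)
    moreover have "a powr (- s - real c) = 1 / a powr (s + real c)"
      by (simp only: powr_minus_divide[symmetric] minus_add_distrib diff_conv_add_uminus)
    moreover have "(- 1) ^ c * (- 1) ^ c = (1 :: real)" by (simp add: power_mult_distrib[symmetric])
    ultimately show ?thesis by (simp add: field_simps)
  qed
  ultimately show ?thesis by (simp add: powr_minus_divide)
qed

context batch_arrival_network
begin

lemma occupancy_at_measurable:
  assumes "0 \<le> s" "k \<in> {1..J}"
  shows "(\<lambda>\<omega>. occupancy i s \<omega> k) \<in> measurable M (count_space UNIV)"
proof (rule measurable_source_join[OF _ batch_sources_subset])
  show "(\<lambda>\<omega>. occupancy i s \<omega> k) \<in> measurable (source_join (batch_sources i)) (count_space UNIV)"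
    using measurable_Pair2[OF occupancy_component_measurable[OF assms(2), of i], of s] assms(1)
    by (simp add: space_restrict_space)
qed

text \<open>
  The queues in \<open>A\<close> are those whose count has already been fixed. At every stage the expectation is a
  constant times \<open>d A z powr (-(r + \<Sum>k\<in>A. y k))\<close>, where \<open>d A z\<close> is affine in each \<open>z k\<close>; fixing one
  more count therefore takes one binomial series and raises the exponent by \<open>y a\<close>.
\<close>

lemma occupancy_negative_multinomial:
  fixes \<nu> r s :: real
  assumes \<nu>: "0 < \<nu>" and r: "0 < r"
    and pgf: "\<And>z. z \<in> {0..1} \<Longrightarrow> pgf S z = 1 / (1 + \<nu> * (1 - z)) powr r"
    and s: "0 \<le> s" and y: "y \<in> (\<Pi>\<^sub>E k\<in>{1..J}. UNIV)"
  shows "expectation (\<lambda>\<omega>. of_bool (occupancy i s \<omega> = y)) =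
     Gamma (r + real (\<Sum>k=1..J. y k)) / (Gamma r * (\<Prod>k=1..J. fact (y k))) *
     (\<nu> ^ (\<Sum>k=1..J. y k) / (1 + \<nu> * (\<Sum>k=1..J. queue_prob J p q k s)) powr (r + real (\<Sum>k=1..J. y k))) *
     (\<Prod>k=1..J. queue_prob J p q k s ^ y k)"
proof -
  define Q where "Q k = queue_prob J p q k s" for k
  have Q0: "0 \<le> Q k" if "k \<in> {1..J}" for k unfolding Q_def by (rule queue_prob_nonneg[OF s that])
  let ?U = "{1..J}"
  let ?Y = "occupancy i s"
  note Ym [measurable] = occupancy_at_measurable[OF s]
  define d where "d A z = 1 + \<nu> * ((\<Sum>k\<in>?U. Q k) - (\<Sum>k\<in>?U - A. Q k * z k))" for A z
  have d1: "1 \<le> d A z" if "A \<subseteq> ?U" "\<And>k. k \<in> ?U \<Longrightarrow> 0 \<le> z k \<and> z k \<le> 1" for A z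
  proof -
    have "(\<Sum>k\<in>?U - A. Q k * z k) \<le> (\<Sum>k\<in>?U - A. Q k)"
      using that Q0 by (intro sum_mono mult_left_le) auto
    also have "\<dots> \<le> (\<Sum>k\<in>?U. Q k)" using Q0 by (intro sum_mono2) auto
    finally show ?thesis using \<nu> by (simp add: d_def)
  qed
  have Q_le1: "(\<Sum>k\<in>?U. Q k) \<le> 1"
    unfolding Q_def by (rule queue_prob_sum_le_one[OF s])
  have "expectation (\<lambda>\<omega>. (\<Prod>k\<in>A. of_bool (?Y \<omega> k = y k)) * (\<Prod>k\<in>?U - A. z k ^ ?Y \<omega> k)) =
       Gamma (r + real (\<Sum>k\<in>A. y k)) / (Gamma r * (\<Prod>k\<in>A. fact (y k))) *
       (\<nu> ^ (\<Sum>k\<in>A. y k) / d A z powr (r + real (\<Sum>k\<in>A. y k))) * (\<Prod>k\<in>A. Q k ^ y k)"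
    if "A \<subseteq> ?U" "\<And>k. k \<in> ?U \<Longrightarrow> 0 \<le> z k \<and> z k \<le> 1" for A z
    using finite_subset[OF that(1) finite_atLeastAtMost] that
  proof (induction A arbitrary: z)
    case empty
    have "expectation (\<lambda>\<omega>. \<Prod>k=1..J. z k ^ ?Y \<omega> k) = pgf S (1 - (\<Sum>k\<in>?U. (1 - z k) * Q k))"
      unfolding Q_def by (rule occupancy_pgf[OF s empty(2)])
    also have "\<dots> = 1 / (1 + \<nu> * (1 - (1 - (\<Sum>k\<in>?U. (1 - z k) * Q k)))) powr r"
    proof (rule pgf)
      have "(\<Sum>k\<in>?U. (1 - z k) * Q k) \<le> (\<Sum>k\<in>?U. Q k)"
        using empty Q0 by (intro sum_mono mult_left_le_one_le) auto
      moreover have "0 \<le> (\<Sum>k\<in>?U. (1 - z k) * Q k)"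
        using empty Q0 by (intro sum_nonneg mult_nonneg_nonneg) auto
      ultimately show "1 - (\<Sum>k\<in>?U. (1 - z k) * Q k) \<in> {0..1}" using Q_le1 by auto
    qed
    also have "1 + \<nu> * (1 - (1 - (\<Sum>k\<in>?U. (1 - z k) * Q k))) = d {} z"
      by (simp add: d_def left_diff_distrib right_diff_distrib sum_subtractf mult.commute)
    finally show ?case using Gamma_real_pos[OF r, THEN less_imp_neq] by simp
  next
    case (insert a A)
    have aU: "a \<in> ?U" and AU: "A \<subseteq> ?U" using insert.prems by auto
    have UA: "?U - A = insert a (?U - insert a A)" using insert aU by auto
    define s' where "s' = r + real (\<Sum>k\<in>A. y k)"
    have s': "0 < s'" unfolding s'_def using r by (intro add_pos_nonneg of_nat_0_le_iff)
    define C where "C = Gamma s' / (Gamma r * (\<Prod>k\<in>A. fact (y k))) * \<nu> ^ (\<Sum>k\<in>A. y k) * (\<Prod>k\<in>A. Q k ^ y k)"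
    define Z where "Z \<omega> = (\<Prod>k\<in>A. of_bool (?Y \<omega> k = y k)) * (\<Prod>k\<in>?U - insert a A. z k ^ ?Y \<omega> k)" for \<omega>
    have z01: "0 \<le> z k ^ m" "z k ^ m \<le> 1" if "k \<in> ?U" for k m
      using insert.prems(2)[OF that] by (auto intro: power_le_one)
    have P1: "0 \<le> (\<Prod>k\<in>?U - insert a A. z k ^ ?Y \<omega> k)" "(\<Prod>k\<in>?U - insert a A. z k ^ ?Y \<omega> k) \<le> 1" for \<omega>
      using z01 by (auto intro!: prod_nonneg prod_le_1)
    have P2: "0 \<le> (\<Prod>k\<in>A. of_bool (?Y \<omega> k = y k) :: real)" "(\<Prod>k\<in>A. of_bool (?Y \<omega> k = y k) :: real) \<le> 1" for \<omega>
      by (auto intro!: prod_nonneg prod_le_1)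
    have "expectation (\<lambda>\<omega>. Z \<omega> * of_bool (?Y \<omega> a = y a)) =
        C * (Gamma (s' + real (y a)) / (Gamma s' * fact (y a)) * (\<nu> * Q a) ^ y a / d (insert a A) z powr (s' + real (y a)))"
    proof (rule expectation_power_coefficient[OF Ym[OF aU]])
      show "Z \<in> borel_measurable M"
        unfolding Z_def using AU by (intro borel_measurable_times borel_measurable_prod) auto
      show "0 \<le> Z \<omega>" for \<omega> unfolding Z_def using P1 P2 by simp
      show "Z \<omega> \<le> 1" for \<omega> unfolding Z_def using P1 P2 by (intro mult_le_one)
      fix x :: real assume x: "0 < x" "x < 1"
      define z' where "z' = z(a := x)"
      have z': "0 \<le> z' k \<and> z' k \<le> 1" if "k \<in> ?U" for k
        using insert.prems(2)[OF that] x by (auto simp: z'_def)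
      have d_eq: "d A z' = d (insert a A) z - \<nu> * Q a * x"
      proof -
        have "(\<Sum>k\<in>?U - insert a A. Q k * z' k) = (\<Sum>k\<in>?U - insert a A. Q k * z k)"
          by (intro sum.cong) (auto simp: z'_def)
        then show ?thesis unfolding d_def UA by (simp add: z'_def algebra_simps)
      qed
      have dd: "1 \<le> d (insert a A) z - \<nu> * Q a * x"
        unfolding d_eq[symmetric] by (rule d1[OF AU]) (rule z')
      have "expectation (\<lambda>\<omega>. (\<Prod>k\<in>A. of_bool (?Y \<omega> k = y k)) * (\<Prod>k\<in>?U - A. z' k ^ ?Y \<omega> k)) = C * (1 / d A z' powr s')"
        using insert.IH[OF AU z'] by (simp add: C_def s'_def)
      also have "(\<lambda>\<omega>. (\<Prod>k\<in>A. of_bool (?Y \<omega> k = y k)) * (\<Prod>k\<in>?U - A. z' k ^ ?Y \<omega> k)) = (\<lambda>\<omega>. Z \<omega> * x ^ ?Y \<omega> a)"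
      proof
        fix \<omega>
        have "(\<Prod>k\<in>?U - insert a A. z' k ^ ?Y \<omega> k) = (\<Prod>k\<in>?U - insert a A. z k ^ ?Y \<omega> k)"
          by (intro prod.cong) (auto simp: z'_def)
        then show "(\<Prod>k\<in>A. of_bool (?Y \<omega> k = y k)) * (\<Prod>k\<in>?U - A. z' k ^ ?Y \<omega> k) = Z \<omega> * x ^ ?Y \<omega> a"
          unfolding UA Z_def by (simp add: z'_def)
      qed
      finally have E: "expectation (\<lambda>\<omega>. Z \<omega> * x ^ ?Y \<omega> a) = C * (1 / (d (insert a A) z - \<nu> * Q a * x) powr s')"
        unfolding d_eq .
      have "(\<lambda>c. C * (Gamma (s' + real c) / (Gamma s' * fact c) * (\<nu> * Q a) ^ c / d (insert a A) z powr (s' + real c) * x ^ c)) sums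
         (C * (1 / (d (insert a A) z - \<nu> * Q a * x) powr s'))"
        using \<nu> Q0[OF aU] x dd s' by (intro sums_mult negative_binomial_series) auto
      then show "(\<lambda>c. C * (Gamma (s' + real c) / (Gamma s' * fact c) * (\<nu> * Q a) ^ c / d (insert a A) z powr (s' + real c)) * x ^ c)
          sums expectation (\<lambda>\<omega>. Z \<omega> * x ^ ?Y \<omega> a)"
        unfolding E by (simp add: mult_ac)
    qed
    moreover have "(\<lambda>\<omega>. (\<Prod>k\<in>insert a A. of_bool (?Y \<omega> k = y k)) * (\<Prod>k\<in>?U - insert a A. z k ^ ?Y \<omega> k))
       = (\<lambda>\<omega>. Z \<omega> * of_bool (?Y \<omega> a = y a))"
      using insert.hyps by (simp add: Z_def fun_eq_iff)
    moreover have "C * (Gamma (s' + real (y a)) / (Gamma s' * fact (y a)) * (\<nu> * Q a) ^ y a / d (insert a A) z powr (s' + real (y a)))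
      = Gamma (r + real (\<Sum>k\<in>insert a A. y k)) / (Gamma r * (\<Prod>k\<in>insert a A. fact (y k))) *
       (\<nu> ^ (\<Sum>k\<in>insert a A. y k) / d (insert a A) z powr (r + real (\<Sum>k\<in>insert a A. y k))) * (\<Prod>k\<in>insert a A. Q k ^ y k)"
    proof -
      have e: "r + real (\<Sum>k\<in>insert a A. y k) = s' + real (y a)" using insert.hyps by (simp add: s'_def)
      have "Gamma s' \<noteq> 0" using Gamma_real_pos[OF s', THEN less_imp_neq] by simp
      then show ?thesis
        unfolding e using insert.hyps by (simp add: C_def power_mult_distrib power_add mult_ac)
    qed
    ultimately show ?case by (simp only:)
  qed
  from this[of ?U "\<lambda>_. 1"]
  have "expectation (\<lambda>\<omega>. \<Prod>k\<in>?U. of_bool (?Y \<omega> k = y k)) =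
       Gamma (r + real (\<Sum>k\<in>?U. y k)) / (Gamma r * (\<Prod>k\<in>?U. fact (y k))) *
       (\<nu> ^ (\<Sum>k\<in>?U. y k) / (1 + \<nu> * (\<Sum>k\<in>?U. Q k)) powr (r + real (\<Sum>k\<in>?U. y k))) * (\<Prod>k\<in>?U. Q k ^ y k)"
    by (simp add: d_def)
  moreover have "(\<Prod>k\<in>?U. of_bool (?Y \<omega> k = y k)) = (of_bool (?Y \<omega> = y) :: real)" for \<omega>
  proof (cases "?Y \<omega> = y")
    case False
    then obtain k where "k \<in> ?U" "?Y \<omega> k \<noteq> y k"
      using PiE_ext[OF occupancy_PiE y] by blast
    then have "(\<Prod>k\<in>?U. of_bool (?Y \<omega> k = y k)) = (0 :: real)"
      by (intro prod_zero) auto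
    then show ?thesis using False by simp
  qed simp
  ultimately show ?thesis unfolding Q_def by simp
qed

end

section \<open>Multiplicities of occupancy vectors\<close>

text \<open>
  The ways to write \<open>m\<close> as a sum of vectors from \<open>F\<close>, where \<open>c y\<close> is the multiplicity of \<open>y\<close>.
\<close>

definition compositions :: "(nat \<Rightarrow> nat) set \<Rightarrow> nat set \<Rightarrow> (nat \<Rightarrow> nat) \<Rightarrow> ((nat \<Rightarrow> nat) \<Rightarrow> nat) set" where
  "compositions F U m = {c \<in> (\<Pi>\<^sub>E y\<in>F. UNIV). \<forall>k\<in>U. (\<Sum>y\<in>F. c y * y k) = m k}"

text \<open>
  Up to the normalising constant, the probability that independent Poisson variables with means \<open>\<eta> y\<close>
  take the values \<open>c y\<close>.
\<close>

definition poisson_weight :: "('i \<Rightarrow> real) \<Rightarrow> 'i set \<Rightarrow> ('i \<Rightarrow> nat) \<Rightarrow> real" where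
  "poisson_weight \<eta> F c = (\<Prod>y\<in>F. \<eta> y ^ c y / fact (c y))"

text \<open>
  Without the null vector in \<open>F\<close> every multiplicity is bounded by the total of \<open>m\<close>.
\<close>

lemma finite_compositions:
  assumes F: "finite F" and U: "finite U" and nz: "\<And>y. y \<in> F \<Longrightarrow> \<exists>k\<in>U. 0 < y k"
  shows "finite (compositions F U m)"
proof (rule finite_subset)
  show "finite (\<Pi>\<^sub>E y\<in>F. {..\<Sum>k\<in>U. m k})" using F by (intro finite_PiE) auto
  show "compositions F U m \<subseteq> (\<Pi>\<^sub>E y\<in>F. {..\<Sum>k\<in>U. m k})"
  proof
    fix c assume c: "c \<in> compositions F U m"
    have "c y \<le> (\<Sum>k\<in>U. m k)" if y: "y \<in> F" for y
    proof -
      obtain k where k: "k \<in> U" "0 < y k" using nz[OF y] by auto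
      have "c y \<le> c y * y k" using k by simp
      also have "\<dots> \<le> (\<Sum>y\<in>F. c y * y k)" using y F by (intro member_le_sum) auto
      also have "\<dots> = m k" using c k by (simp add: compositions_def)
      also have "\<dots> \<le> (\<Sum>k\<in>U. m k)" using k U by (intro member_le_sum) auto
      finally show ?thesis .
    qed
    then show "c \<in> (\<Pi>\<^sub>E y\<in>F. {..\<Sum>k\<in>U. m k})" using c by (auto simp: compositions_def PiE_iff)
  qed
qed

lemma poisson_weight_remove:
  assumes F: "finite F" "y \<in> F" and c: "0 < c y"
  shows "real (c y) * poisson_weight \<eta> F c = \<eta> y * poisson_weight \<eta> F (c(y := c y - 1))"
proof -
  obtain d where d: "c y = Suc d" using c by (cases "c y") auto
  have rest: "(\<Prod>x\<in>F - {y}. \<eta> x ^ (c(y := d)) x / fact ((c(y := d)) x)) = (\<Prod>x\<in>F - {y}. \<eta> x ^ c x / fact (c x))"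
    by (intro prod.cong) auto
  have "real (c y) * poisson_weight \<eta> F c
      = real (Suc d) * (\<eta> y ^ Suc d / fact (Suc d)) * (\<Prod>x\<in>F - {y}. \<eta> x ^ c x / fact (c x))"
    unfolding poisson_weight_def prod.remove[OF F] d by (simp only: mult.assoc)
  also have "real (Suc d) * (\<eta> y ^ Suc d / fact (Suc d)) = \<eta> y * (\<eta> y ^ d / fact d)"
    by (simp add: fact_Suc del: of_nat_Suc)
  also have "\<eta> y * (\<eta> y ^ d / fact d) * (\<Prod>x\<in>F - {y}. \<eta> x ^ c x / fact (c x)) = \<eta> y * poisson_weight \<eta> F (c(y := d))"
    unfolding poisson_weight_def prod.remove[OF F] rest by (simp only: fun_upd_same mult.assoc)
  finally show ?thesis by (simp add: d)
qed

text \<open>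
  Write \<open>n v\<close> as \<open>\<Sum>y. c y \<cdot> y v\<close> under the sum over \<open>c\<close>. Since \<open>c y \<cdot> \<eta> y ^ c y / c y!\<close> equals
  \<open>\<eta> y \<cdot> \<eta> y ^ (c y - 1) / (c y - 1)!\<close>, removing one copy of \<open>y\<close> maps the compositions of \<open>n\<close> that
  contain \<open>y\<close> bijectively to those of \<open>n - y\<close>.
\<close>

lemma compositions_recursion:
  assumes F: "finite F" and U: "finite U" and nz: "\<And>y. y \<in> F \<Longrightarrow> \<exists>k\<in>U. 0 < y k"
    and le: "\<And>y k. y \<in> F \<Longrightarrow> k \<in> U \<Longrightarrow> y k \<le> n k" and v: "v \<in> U"
  shows "real (n v) * (\<Sum>c\<in>compositions F U n. poisson_weight \<eta> F c) =
     (\<Sum>y\<in>F. real (y v) * \<eta> y * (\<Sum>c\<in>compositions F U (\<lambda>k. n k - y k). poisson_weight \<eta> F c))"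
proof -
  let ?W = "poisson_weight \<eta> F"
  have shift: "(\<Sum>c\<in>compositions F U n. real (c y) * ?W c) = \<eta> y * (\<Sum>c\<in>compositions F U (\<lambda>k. n k - y k). ?W c)"
    if y: "y \<in> F" for y
  proof -
    have split: "(\<Sum>x\<in>F. c x * x k) = c y * y k + (\<Sum>x\<in>F - {y}. c x * x k)" for c :: "(nat \<Rightarrow> nat) \<Rightarrow> nat" and k
      by (rule sum.remove[OF F y])
    have upd: "(\<Sum>x\<in>F. (c(y := d)) x * x k) = d * y k + (\<Sum>x\<in>F - {y}. c x * x k)" for c :: "(nat \<Rightarrow> nat) \<Rightarrow> nat" and d k
    proof -
      have "(\<Sum>x\<in>F - {y}. (c(y := d)) x * x k) = (\<Sum>x\<in>F - {y}. c x * x k)" by (intro sum.cong) auto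
      then show ?thesis using split[of "c(y := d)" k] by simp
    qed
    have "(\<Sum>c\<in>compositions F U n. real (c y) * ?W c) = (\<Sum>c\<in>{c \<in> compositions F U n. 0 < c y}. real (c y) * ?W c)"
      using finite_compositions[OF F U nz] by (intro sum.mono_neutral_right) auto
    also have "\<dots> = (\<Sum>c\<in>{c \<in> compositions F U n. 0 < c y}. \<eta> y * ?W (c(y := c y - 1)))"
      using poisson_weight_remove[OF F y] by (intro sum.cong) auto
    also have "\<dots> = (\<Sum>c\<in>compositions F U (\<lambda>k. n k - y k). \<eta> y * ?W c)"
    proof (rule sum.reindex_bij_witness[where i="\<lambda>c. c(y := Suc (c y))" and j="\<lambda>c. c(y := c y - 1)"])
      fix c assume c: "c \<in> {c \<in> compositions F U n. 0 < c y}"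
      show "(c(y := c y - 1))(y := Suc ((c(y := c y - 1)) y)) = c" using c by auto
      have "(\<Sum>x\<in>F. (c(y := c y - 1)) x * x k) = n k - y k" if "k \<in> U" for k
      proof -
        have "c y * y k + (\<Sum>x\<in>F - {y}. c x * x k) = n k"
          using c that split[of c k] by (simp add: compositions_def)
        moreover obtain d where "c y = Suc d" using c by (cases "c y") auto
        ultimately show ?thesis unfolding upd by simp
      qed
      then show "c(y := c y - 1) \<in> compositions F U (\<lambda>k. n k - y k)"
        using c y by (auto simp: compositions_def PiE_iff extensional_def)
    next
      fix c assume c: "c \<in> compositions F U (\<lambda>k. n k - y k)"
      show "(c(y := Suc (c y)))(y := (c(y := Suc (c y))) y - 1) = c" by simp
      have "(\<Sum>x\<in>F. (c(y := Suc (c y))) x * x k) = n k" if "k \<in> U" for k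
      proof -
        have "c y * y k + (\<Sum>x\<in>F - {y}. c x * x k) = n k - y k"
          using c that split[of c k] by (simp add: compositions_def)
        then show ?thesis unfolding upd using le[OF y that] by simp
      qed
      then show "c(y := Suc (c y)) \<in> {c \<in> compositions F U n. 0 < c y}"
        using c y by (auto simp: compositions_def PiE_iff extensional_def)
    qed auto
    finally show ?thesis by (simp add: sum_distrib_left)
  qed
  have "real (n v) * (\<Sum>c\<in>compositions F U n. ?W c) = (\<Sum>c\<in>compositions F U n. \<Sum>y\<in>F. real (y v) * (real (c y) * ?W c))"
    unfolding sum_distrib_left
  proof (rule sum.cong)
    fix c assume "c \<in> compositions F U n"
    then have "real (n v) = real (\<Sum>y\<in>F. c y * y v)" using v by (simp add: compositions_def)
    then show "real (n v) * ?W c = (\<Sum>y\<in>F. real (y v) * (real (c y) * ?W c))"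
      by (simp add: sum_distrib_left mult_ac)
  qed simp
  also have "\<dots> = (\<Sum>y\<in>F. real (y v) * (\<Sum>c\<in>compositions F U n. real (c y) * ?W c))"
    by (subst sum.swap) (simp add: sum_distrib_left)
  also have "\<dots> = (\<Sum>y\<in>F. real (y v) * \<eta> y * (\<Sum>c\<in>compositions F U (\<lambda>k. n k - y k). ?W c))"
    using shift by (intro sum.cong) auto
  finally show ?thesis .
qed

text \<open>
  If the vectors sum to \<open>m \<le> n\<close> then each of them is at most \<open>n\<close>, so the event \<open>N = m\<close> is determined by
  the multiplicities of the vectors in \<open>F\<close> and the absence of vectors that exceed \<open>n\<close>. The bound \<open>n\<close> is
  kept apart from \<open>m\<close> so that the same \<open>F\<close> serves for \<open>n\<close> and for all \<open>n - y\<close>.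
\<close>

lemma sum_vectors_iff_multiplicities:
  fixes Y :: "'i \<Rightarrow> nat \<Rightarrow> nat"
  assumes I: "finite I" and U: "finite U"
    and Y: "\<And>i. i \<in> I \<Longrightarrow> Y i \<in> (\<Pi>\<^sub>E k\<in>U. UNIV)"
    and F: "F = (\<Pi>\<^sub>E k\<in>U. {0..n k}) - {\<lambda>k\<in>U. 0}"
    and m: "\<And>k. k \<in> U \<Longrightarrow> m k \<le> n k"
  shows "(\<forall>k\<in>U. (\<Sum>i\<in>I. Y i k) = m k) \<longleftrightarrow>
     (\<forall>i\<in>I. Y i \<in> (\<Pi>\<^sub>E k\<in>U. {0..n k})) \<and> (\<lambda>y\<in>F. card {i \<in> I. Y i = y}) \<in> compositions F U m"
proof -
  let ?box = "\<Pi>\<^sub>E k\<in>U. {0..n k}"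
  have fin: "finite ?box" using U by (intro finite_PiE) auto
  have sum_eq: "(\<Sum>i\<in>I. Y i k) = (\<Sum>y\<in>F. card {i \<in> I. Y i = y} * y k)"
    if box: "\<forall>i\<in>I. Y i \<in> ?box" and k: "k \<in> U" for k
  proof -
    have "(\<Sum>i\<in>I. Y i k) = (\<Sum>y\<in>?box. \<Sum>i\<in>{i \<in> I. Y i = y}. Y i k)"
      using box by (intro sum.group[symmetric] I fin) auto
    also have "\<dots> = (\<Sum>y\<in>?box. card {i \<in> I. Y i = y} * y k)"
      by (intro sum.cong refl) simp
    also have "\<dots> = (\<Sum>y\<in>F. card {i \<in> I. Y i = y} * y k)"
      unfolding F using fin k by (intro sum.mono_neutral_right) auto
    finally show ?thesis .
  qed
  have comp: "(\<lambda>y\<in>F. card {i \<in> I. Y i = y}) \<in> compositions F U m \<longleftrightarrow> (\<forall>k\<in>U. (\<Sum>y\<in>F. card {i \<in> I. Y i = y} * y k) = m k)"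
    by (auto simp: compositions_def)
  show ?thesis
  proof
    assume L: "\<forall>k\<in>U. (\<Sum>i\<in>I. Y i k) = m k"
    have box: "\<forall>i\<in>I. Y i \<in> ?box"
    proof
      fix i assume i: "i \<in> I"
      have "Y i k \<le> n k" if k: "k \<in> U" for k
      proof -
        have "Y i k \<le> (\<Sum>i\<in>I. Y i k)" using I i by (intro member_le_sum) auto
        then show ?thesis using L m k by fastforce
      qed
      then show "Y i \<in> ?box" using Y[OF i] by (auto simp: PiE_iff)
    qed
    then show "(\<forall>i\<in>I. Y i \<in> ?box) \<and> (\<lambda>y\<in>F. card {i \<in> I. Y i = y}) \<in> compositions F U m"
      using L sum_eq comp by auto
  next
    assume "(\<forall>i\<in>I. Y i \<in> ?box) \<and> (\<lambda>y\<in>F. card {i \<in> I. Y i = y}) \<in> compositions F U m"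
    then show "\<forall>k\<in>U. (\<Sum>i\<in>I. Y i k) = m k" using sum_eq comp by auto
  qed
qed

text \<open>
  The weight is \<open>1\<close> for the null vector, which does not count, and \<open>0\<close> for vectors outside
  \<open>insert null F\<close>, which produces the indicator.
\<close>

lemma prod_weights_multiplicities:
  fixes Y :: "'i \<Rightarrow> 'b" and w :: "'b \<Rightarrow> real"
  assumes I: "finite I" and F: "finite F" and null: "null \<notin> F"
  shows "(\<Prod>i\<in>I. \<Sum>y\<in>insert null F. (w(null := 1)) y * of_bool (Y i = y)) =
     of_bool (\<forall>i\<in>I. Y i \<in> insert null F) * (\<Prod>y\<in>F. w y ^ card {i \<in> I. Y i = y})"
proof -
  let ?u = "w(null := 1)"
  have single: "(\<Sum>y\<in>insert null F. ?u y * of_bool (Y i = y)) = (if Y i \<in> insert null F then ?u (Y i) else 0)" for i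
  proof -
    have "(\<Sum>y\<in>insert null F. ?u y * of_bool (Y i = y)) = (\<Sum>y\<in>insert null F. if y = Y i then ?u y else 0)"
      by (intro sum.cong) auto
    then show ?thesis using F by (simp add: sum.delta)
  qed
  show ?thesis
  proof (cases "\<forall>i\<in>I. Y i \<in> insert null F")
    case True
    then have "(\<Prod>i\<in>I. \<Sum>y\<in>insert null F. ?u y * of_bool (Y i = y)) = (\<Prod>i\<in>I. ?u (Y i))"
      unfolding single by (intro prod.cong) auto
    also have "\<dots> = (\<Prod>y\<in>insert null F. \<Prod>i\<in>{i \<in> I. Y i = y}. ?u (Y i))"
      using True F by (intro prod.group[symmetric] I) auto
    also have "\<dots> = (\<Prod>y\<in>insert null F. ?u y ^ card {i \<in> I. Y i = y})"
      by (intro prod.cong refl) simp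
    also have "\<dots> = (\<Prod>y\<in>F. ?u y ^ card {i \<in> I. Y i = y})" using F null by simp
    also have "\<dots> = (\<Prod>y\<in>F. w y ^ card {i \<in> I. Y i = y})" using null by (intro prod.cong) auto
    finally show ?thesis using True by simp
  next
    case False
    then obtain i where "i \<in> I" "Y i \<notin> insert null F" by auto
    then have "(\<Prod>i\<in>I. \<Sum>y\<in>insert null F. ?u y * of_bool (Y i = y)) = 0"
      unfolding single using I by (intro prod_zero) auto
    then show ?thesis using False by simp
  qed
qed

section \<open>Recursion for the network\<close>

lemma set_integral_finite_sum:
  fixes h :: "'i \<Rightarrow> 'b \<Rightarrow> real"
  assumes "\<And>y. y \<in> A \<Longrightarrow> set_integrable N B (h y)"
  shows "set_integrable N B (\<lambda>x. \<Sum>y\<in>A. h y x)"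
    and "(LINT x:B|N. (\<Sum>y\<in>A. h y x)) = (\<Sum>y\<in>A. LINT x:B|N. h y x)"
  using assms unfolding set_integrable_def set_lebesgue_integral_def by (auto simp: sum_distrib_left)

context batch_arrival_network
begin

lemma occupancy_at_age_measurable:
  assumes "y \<in> (\<Pi>\<^sub>E k\<in>{1..J}. UNIV)"
  shows "Measurable.pred (borel \<Otimes>\<^sub>M M) (\<lambda>(\<tau>, \<omega>). occupancy i (max 0 (t - \<tau>)) \<omega> = y)"
proof -
  have "(\<lambda>x. x) \<in> measurable M (source_join (batch_sources i))"
    by (rule measurable_source_join[OF _ batch_sources_subset[of i]]) simp
  then have "(\<lambda>z. (fst z, snd z)) \<in> measurable (borel \<Otimes>\<^sub>M M) (borel \<Otimes>\<^sub>M source_join (batch_sources i))"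
    by (intro measurable_Pair measurable_fst measurable_compose[OF measurable_snd])
  from measurable_compose[OF this occupancy_age_measurable[OF assms order_refl]]
  show ?thesis by (simp add: case_prod_beta')
qed

abbreviation batch_occupancy :: "real \<Rightarrow> nat \<Rightarrow> 'a \<Rightarrow> nat \<Rightarrow> nat" where
  "batch_occupancy t i \<omega> \<equiv> occupancy i (max 0 (t - real_of_ereal (T i \<omega>))) \<omega>"

lemma batch_occupancy_measurable:
  assumes "y \<in> (\<Pi>\<^sub>E k\<in>{1..J}. UNIV)"
  shows "Measurable.pred M (\<lambda>\<omega>. batch_occupancy t i \<omega> = y)"
proof -
  note [measurable] = points_measurable
  have "(\<lambda>\<omega>. (real_of_ereal (T i \<omega>), \<omega>)) \<in> measurable M (borel \<Otimes>\<^sub>M M)" by measurable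
  from measurable_compose[OF this occupancy_at_age_measurable[OF assms]] show ?thesis by simp
qed

lemma routing_at_age_measurable:
  assumes "j \<in> {1..J}"
  shows "(\<lambda>\<omega>. X j i l (max 0 (t - real_of_ereal (T i \<omega>))) \<omega>) \<in> measurable M (count_space UNIV)"
proof -
  note [measurable] = points_measurable
  have "(\<lambda>\<omega>. max 0 (t - real_of_ereal (T i \<omega>))) \<in> measurable M (restrict_space borel {0..})"
    by (intro measurable_restrict_space2) auto
  moreover have "(\<lambda>x. x) \<in> measurable M (source_join (batch_sources i))"
    by (rule measurable_source_join[OF _ batch_sources_subset[of i]]) simp
  ultimately have "(\<lambda>\<omega>. (max 0 (t - real_of_ereal (T i \<omega>)), \<omega>)) \<in> measurable M (restrict_space borel {0..} \<Otimes>\<^sub>M source_join (batch_sources i))"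
    by (rule measurable_Pair)
  from measurable_compose[OF this routing_source_measurable[of j i l]] show ?thesis
    using assms by (auto simp: batch_sources_def)
qed

lemma age_nonneg_eq:
  assumes "0 \<le> t" "T i \<omega> \<le> ereal t"
  shows "max 0 (t - real_of_ereal (T i \<omega>)) = t - real_of_ereal (T i \<omega>)"
  using assms by (cases "T i \<omega>") auto

text \<open>
  The number in a queue equals a sum over batches only when finitely many batches have arrived, and the
  exceptional null set need not have measurable subsets only. Measurability is therefore shown for the
  cardinality itself, after carrying the set of triples over to the natural numbers by \<open>prod_decode\<close>.
\<close>

lemma number_in_queue_measurable:
  assumes t: "0 \<le> t"
  shows "number_in_queue T J B X t k \<in> measurable M (count_space UNIV)"
proof -
  define S where "S \<omega> = {(i, j, l). T i \<omega> \<le> ereal t \<and> j \<in> {1..J} \<and> l < B i j \<omega> \<and>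
      X j i l (t - real_of_ereal (T i \<omega>)) \<omega> = k}" for \<omega>
  define dec where "dec x = (let (i, x') = prod_decode x; (j, l) = prod_decode x' in (i, j, l))" for x
  have bij: "bij dec"
    by (rule o_bij[where g="\<lambda>(i, j, l). prod_encode (i, prod_encode (j, l))"])
       (auto simp: dec_def fun_eq_iff split: prod.splits, metis prod_decode_inverse)
  have "card (S \<omega>) = card {x. dec x \<in> S \<omega>}" for \<omega>
    using card_vimage_inj[of dec "S \<omega>"] bij by (auto simp: bij_def vimage_def)
  moreover have "(\<lambda>\<omega>. card {x. dec x \<in> S \<omega>}) \<in> measurable M (count_space UNIV)"
  proof (rule measurable_card)
    fix x
    obtain i j l where x: "dec x = (i, j, l)" by (cases "dec x") auto
    note [measurable] = points_measurable
    show "{\<omega> \<in> space M. x \<in> {x. dec x \<in> S \<omega>}} \<in> sets M"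
    proof (cases "j \<in> {1..J}")
      case True
      note [measurable] = batch_measurable[OF True] routing_at_age_measurable[OF True]
      have "{\<omega> \<in> space M. x \<in> {x. dec x \<in> S \<omega>}} = {\<omega> \<in> space M. T i \<omega> \<le> ereal t \<and> l < B i j \<omega> \<and>
         X j i l (max 0 (t - real_of_ereal (T i \<omega>))) \<omega> = k}"
        using True age_nonneg_eq[OF t, of i] by (auto simp: S_def x)
      then show ?thesis by simp
    next
      case False
      then have "{\<omega> \<in> space M. x \<in> {x. dec x \<in> S \<omega>}} = {}" by (auto simp: S_def x)
      then show ?thesis by (simp only: sets.empty_sets)
    qed
  qed
  moreover have "number_in_queue T J B X t k = (\<lambda>\<omega>. card (S \<omega>))"
    by (simp add: number_in_queue_def S_def fun_eq_iff)
  ultimately show ?thesis by simp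
qed

lemma number_in_queue_eq_sum:
  assumes t: "0 \<le> t" and fin: "finite (arrived t \<omega>)" and k: "k \<in> {1..J}"
  shows "number_in_queue T J B X t k \<omega> = (\<Sum>i\<in>arrived t \<omega>. batch_occupancy t i \<omega> k)"
proof -
  let ?a = "\<lambda>i. t - real_of_ereal (T i \<omega>)"
  have "{(i, j, l). T i \<omega> \<le> ereal t \<and> j \<in> {1..J} \<and> l < B i j \<omega> \<and> X j i l (?a i) \<omega> = k}
      = (SIGMA i:arrived t \<omega>. SIGMA j:{1..J}. {l \<in> {..<B i j \<omega>}. X j i l (?a i) \<omega> = k})"
    by (auto simp: arrived_def)
  then have "number_in_queue T J B X t k \<omega> = (\<Sum>i\<in>arrived t \<omega>. \<Sum>j=1..J. card {l \<in> {..<B i j \<omega>}. X j i l (?a i) \<omega> = k})"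
    unfolding number_in_queue_def using fin by simp
  also have "\<dots> = (\<Sum>i\<in>arrived t \<omega>. batch_occupancy t i \<omega> k)"
  proof (intro sum.cong refl)
    fix i assume "i \<in> arrived t \<omega>"
    then have a: "max 0 (?a i) = ?a i" using age_nonneg_eq[OF t] by (simp add: arrived_def)
    show "(\<Sum>j=1..J. card {l \<in> {..<B i j \<omega>}. X j i l (?a i) \<omega> = k}) = batch_occupancy t i \<omega> k"
      unfolding a occupancy_def using k by (simp add: Collect_conj_eq[symmetric] Int_def)
  qed
  finally show ?thesis .
qed

text \<open>
  The compound Poisson recursion, for an arbitrary occupancy law \<open>f\<close>. \<open>Z\<close> is the event that no arrived
  batch has an occupancy vector exceeding \<open>n\<close>, and \<open>K y\<close> counts the batches with vector \<open>y\<close>. On \<open>Z\<close> the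
  variables \<open>K y\<close> have Poisson weights (\<open>weights\<close>), and each \<open>P(N = m)\<close> with \<open>m \<le> n\<close> is the sum of these
  weights over the compositions of \<open>m\<close> (\<open>law\<close>).
\<close>

lemma prob_N_recursion:
  fixes f :: "real \<Rightarrow> (nat \<Rightarrow> nat) \<Rightarrow> real"
  assumes t: "0 \<le> t" and v: "v \<in> {1..J}"
    and f: "\<And>i s y. 0 \<le> s \<Longrightarrow> y \<in> (\<Pi>\<^sub>E k\<in>{1..J}. {0..n k}) \<Longrightarrow>
        expectation (\<lambda>\<omega>. of_bool (occupancy i s \<omega> = y)) = f s y"
  shows "real (n v) * prob_N M T J B X t n =
    (\<Sum>y \<in> (\<Pi>\<^sub>E k\<in>{1..J}. {0..n k}). real (y v) * prob_N M T J B X t (\<lambda>k. n k - y k) *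
       (LINT \<tau>:{0..t}|lborel. lam \<tau> * f (t - \<tau>) y))"
proof -
  let ?U = "{1..J}"
  define box where "box = (\<Pi>\<^sub>E k\<in>?U. {0..n k})"
  define null where "null = (\<lambda>k\<in>?U. 0 :: nat)"
  define F where "F = box - {null}"
  have box_fin: "finite box" unfolding box_def by (intro finite_PiE) auto
  then have F_fin: "finite F" by (simp add: F_def)
  have null_box: "null \<in> box" by (auto simp: null_def box_def)
  then have box_eq: "box = insert null F" and null_F: "null \<notin> F" by (auto simp: F_def)
  have box_ext: "y \<in> (\<Pi>\<^sub>E k\<in>?U. UNIV)" if "y \<in> box" for y using that by (auto simp: box_def PiE_iff)
  have f': "expectation (\<lambda>\<omega>. of_bool (occupancy i s \<omega> = y)) = f s y" if "0 \<le> s" "y \<in> box" for i s y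
    using f that by (simp add: box_def)
  define \<eta> where "\<eta> y = (LINT \<tau>:{0..t}|lborel. lam \<tau> * f (t - \<tau>) y)" for y
  define \<Lambda> where "\<Lambda> = (LINT \<tau>:{0..t}|lborel. lam \<tau>)"
  \<comment> \<open>\<open>C\<close> is the probability that every arrived batch has the null vector.\<close>
  define C where "C = exp (\<eta> null - \<Lambda>)"
  define K where "K y \<omega> = card {i \<in> arrived t \<omega>. batch_occupancy t i \<omega> = y}" for y \<omega>
  define Z where "Z \<omega> \<longleftrightarrow> (\<forall>i\<in>arrived t \<omega>. batch_occupancy t i \<omega> \<in> box)" for \<omega>
  note [measurable] = points_measurable
  have ev [measurable]: "Measurable.pred M (\<lambda>\<omega>. batch_occupancy t i \<omega> = y)" if "y \<in> box" for i y
    by (rule batch_occupancy_measurable[OF box_ext[OF that]])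
  have K_meas [measurable]: "K y \<in> measurable M (count_space UNIV)" if "y \<in> box" for y
  proof -
    note [measurable] = ev[OF that]
    show ?thesis unfolding K_def arrived_def by (intro measurable_card) simp
  qed
  have Z_meas [measurable]: "Measurable.pred M Z"
  proof -
    have "Measurable.pred M (\<lambda>\<omega>. \<exists>y\<in>box. batch_occupancy t i \<omega> = y)" for i
      using box_fin ev by (intro pred_intros_finite) auto
    then have [measurable]: "Measurable.pred M (\<lambda>\<omega>. batch_occupancy t i \<omega> \<in> box)" for i by simp
    have "Z = (\<lambda>\<omega>. \<forall>i. T i \<omega> \<le> ereal t \<longrightarrow> batch_occupancy t i \<omega> \<in> box)"
      by (auto simp: Z_def arrived_def fun_eq_iff)
    then show ?thesis by simp
  qed
  have f_int: "set_integrable lborel {0..t} (\<lambda>\<tau>. lam \<tau> * f (t - \<tau>) y)" if y: "y \<in> box" for y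
  proof (rule rate_bounded_set_integrable[OF t])
    have f_max: "f (max 0 (t - \<tau>)) y = expectation (\<lambda>\<omega>. of_bool (occupancy 0 (max 0 (t - \<tau>)) \<omega> = y))" for \<tau>
      using f'[of "max 0 (t - \<tau>)" y 0] y by simp
    have [measurable]: "Measurable.pred (borel \<Otimes>\<^sub>M M) (\<lambda>z. occupancy 0 (max 0 (t - fst z)) (snd z) = y)"
      using occupancy_at_age_measurable[OF box_ext[OF y], where i=0 and t=t] by (simp add: case_prod_beta')
    have "(\<lambda>\<tau>. expectation (\<lambda>\<omega>. of_bool (occupancy 0 (max 0 (t - \<tau>)) \<omega> = y) :: real)) \<in> borel_measurable borel"
      by (rule borel_measurable_lebesgue_integral) (simp add: case_prod_beta')
    then have [measurable]: "(\<lambda>\<tau>. f (max 0 (t - \<tau>)) y) \<in> borel_measurable borel" by (simp only: f_max)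
    have "(\<lambda>\<tau>. indicator {0..t} \<tau> *\<^sub>R f (t - \<tau>) y) = (\<lambda>\<tau>. indicator {0..t} \<tau> *\<^sub>R f (max 0 (t - \<tau>)) y)"
      by (auto simp: indicator_def)
    then show "set_borel_measurable lborel {0..t} (\<lambda>\<tau>. f (t - \<tau>) y)"
      unfolding set_borel_measurable_def by simp
    fix \<tau> assume \<tau>: "\<tau> \<in> {0..t}"
    have "expectation (\<lambda>\<omega>. of_bool (occupancy 0 (t - \<tau>) \<omega> = y)) = expectation (indicat_real {\<omega> \<in> space M. occupancy 0 (t - \<tau>) \<omega> = y})"
      by (intro Bochner_Integration.integral_cong) (auto simp: indicator_def)
    then have "f (t - \<tau>) y = expectation (indicat_real {\<omega> \<in> space M. occupancy 0 (t - \<tau>) \<omega> = y})"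
      using f'[of "t - \<tau>" y 0] y \<tau> by (simp del: Bochner_Integration.integral_indicator)
    then show "\<bar>f (t - \<tau>) y\<bar> \<le> 1" by simp
  qed
  have gen: "expectation (\<lambda>\<omega>. of_bool (Z \<omega>) * (\<Prod>y\<in>F. w y ^ K y \<omega>)) = C * (\<Prod>y\<in>F. exp (\<eta> y * w y))"
    if w: "\<And>y. y \<in> F \<Longrightarrow> 0 \<le> w y \<and> w y \<le> 1" for w
  proof -
    \<comment> \<open>Weight \<open>1\<close> on the null vector and \<open>0\<close> outside \<open>box\<close> turn the product into \<open>Z\<close> times powers.\<close>
    let ?u = "w(null := 1)"
    have "expectation (\<lambda>\<omega>. \<Prod>i\<in>arrived t \<omega>. \<Sum>y\<in>box. ?u y * of_bool (batch_occupancy t i \<omega> = y))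
        = exp (LINT \<tau>:{0..t}|lborel. lam \<tau> * ((\<Sum>y\<in>box. ?u y * f (t - \<tau>) y) - 1))"
      using w box_ext f' by (intro weighted_arrivals_functional[OF t box_fin]) (auto simp: box_eq)
    also have "(LINT \<tau>:{0..t}|lborel. lam \<tau> * ((\<Sum>y\<in>box. ?u y * f (t - \<tau>) y) - 1))
        = (LINT \<tau>:{0..t}|lborel. (\<Sum>y\<in>box. ?u y * (lam \<tau> * f (t - \<tau>) y)) - lam \<tau>)"
      by (simp add: right_diff_distrib sum_distrib_left mult_ac)
    also have "\<dots> = (LINT \<tau>:{0..t}|lborel. (\<Sum>y\<in>box. ?u y * (lam \<tau> * f (t - \<tau>) y))) - \<Lambda>"
      unfolding \<Lambda>_def using f_int rate_integrable[OF t] box_fin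
      by (intro set_integral_diff(2) set_integral_finite_sum(1) set_integrable_mult_right) auto
    also have "(LINT \<tau>:{0..t}|lborel. (\<Sum>y\<in>box. ?u y * (lam \<tau> * f (t - \<tau>) y))) = (\<Sum>y\<in>box. ?u y * \<eta> y)"
      unfolding \<eta>_def using f_int box_fin by (subst set_integral_finite_sum(2)) auto
    also have "exp ((\<Sum>y\<in>box. ?u y * \<eta> y) - \<Lambda>) = C * (\<Prod>y\<in>F. exp (\<eta> y * w y))"
    proof -
      have "(\<Sum>y\<in>F. ?u y * \<eta> y) = (\<Sum>y\<in>F. \<eta> y * w y)" using null_F by (intro sum.cong) auto
      then show ?thesis using F_fin null_F by (simp add: box_eq C_def exp_sum[symmetric] exp_add[symmetric] algebra_simps)
    qed
    finally have lhs: "expectation (\<lambda>\<omega>. \<Prod>i\<in>arrived t \<omega>. \<Sum>y\<in>box. ?u y * of_bool (batch_occupancy t i \<omega> = y))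
      = C * (\<Prod>y\<in>F. exp (\<eta> y * w y))" .
    have ae: "AE \<omega> in M. (\<Prod>i\<in>arrived t \<omega>. \<Sum>y\<in>box. ?u y * of_bool (batch_occupancy t i \<omega> = y))
        = of_bool (Z \<omega>) * (\<Prod>y\<in>F. w y ^ K y \<omega>)"
      using arrived_AE[of t]
    proof eventually_elim
      case (elim \<omega>)
      then show ?case
        unfolding box_eq Z_def K_def by (intro prod_weights_multiplicities F_fin null_F) auto
    qed
    have meas_l: "(\<lambda>\<omega>. \<Prod>i\<in>arrived t \<omega>. \<Sum>y\<in>box. ?u y * of_bool (batch_occupancy t i \<omega> = y)) \<in> borel_measurable M"
      using ev by (intro arrived_prod_measurable borel_measurable_sum) auto
    have meas_r: "(\<lambda>\<omega>. of_bool (Z \<omega>) * (\<Prod>y\<in>F. w y ^ K y \<omega>)) \<in> borel_measurable M"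
    proof (intro borel_measurable_times borel_measurable_prod)
      fix y assume "y \<in> F"
      then have [measurable]: "K y \<in> measurable M (count_space UNIV)" by (intro K_meas) (simp add: F_def)
      show "(\<lambda>\<omega>. w y ^ K y \<omega>) \<in> borel_measurable M" by measurable
    qed measurable
    show ?thesis unfolding integral_cong_AE[OF meas_l meas_r ae, symmetric] by (rule lhs)
  qed
  have weights: "measure M {\<omega> \<in> space M. Z \<omega> \<and> (\<lambda>y\<in>F. K y \<omega>) = c} = C * poisson_weight \<eta> F c"
    if c: "c \<in> (\<Pi>\<^sub>E y\<in>F. UNIV)" for c
  proof -
    have "expectation (\<lambda>\<omega>. of_bool (Z \<omega>) * (\<Prod>y\<in>F. of_bool (K y \<omega> = c y))) = C * (\<Prod>y\<in>F. \<eta> y ^ c y / fact (c y))"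
      using K_meas gen by (intro poisson_weights_from_pgf F_fin) (auto simp: F_def)
    moreover have "of_bool (Z \<omega>) * (\<Prod>y\<in>F. of_bool (K y \<omega> = c y)) = indicat_real {\<omega> \<in> space M. Z \<omega> \<and> (\<lambda>y\<in>F. K y \<omega>) = c} \<omega>"
      if "\<omega> \<in> space M" for \<omega>
    proof -
      have "(\<lambda>y\<in>F. K y \<omega>) = c \<longleftrightarrow> (\<forall>y\<in>F. K y \<omega> = c y)"
        using c by (auto simp: fun_eq_iff PiE_iff extensional_def)
      moreover have "(\<Prod>y\<in>F. of_bool (K y \<omega> = c y)) = (of_bool (\<forall>y\<in>F. K y \<omega> = c y) :: real)"
        using F_fin by (induction F) auto
      ultimately show ?thesis using that by (auto simp: indicator_def)
    qed
    ultimately have "expectation (indicat_real {\<omega> \<in> space M. Z \<omega> \<and> (\<lambda>y\<in>F. K y \<omega>) = c}) = C * (\<Prod>y\<in>F. \<eta> y ^ c y / fact (c y))"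
      by (simp cong: Bochner_Integration.integral_cong)
    moreover have "{\<omega> \<in> space M. Z \<omega> \<and> (\<lambda>y\<in>F. K y \<omega>) = c} \<inter> space M = {\<omega> \<in> space M. Z \<omega> \<and> (\<lambda>y\<in>F. K y \<omega>) = c}"
      by blast
    ultimately show ?thesis by (simp only: Bochner_Integration.integral_indicator real_scaleR_def mult_1_right poisson_weight_def)
  qed
  have nz: "\<exists>k\<in>?U. 0 < y k" if "y \<in> F" for y
  proof (rule ccontr)
    assume "\<not> (\<exists>k\<in>?U. 0 < y k)"
    then have "y = null" using that by (auto simp: F_def box_def null_def PiE_iff extensional_def fun_eq_iff)
    then show False using that by (simp add: F_def)
  qed
  have law: "prob_N M T J B X t m = C * (\<Sum>c\<in>compositions F ?U m. poisson_weight \<eta> F c)"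
    if m: "\<And>k. k \<in> ?U \<Longrightarrow> m k \<le> n k" for m
  proof -
    note comp_fin = finite_compositions[OF F_fin finite_atLeastAtMost nz]
    define A where "A c = {\<omega> \<in> space M. Z \<omega> \<and> (\<lambda>y\<in>F. K y \<omega>) = c}" for c
    have A_meas: "A c \<in> sets M" if "c \<in> compositions F ?U m" for c
    proof -
      have "A c = {\<omega> \<in> space M. Z \<omega> \<and> (\<forall>y\<in>F. K y \<omega> = c y)}"
        using that by (auto simp: A_def compositions_def fun_eq_iff PiE_iff extensional_def)
      moreover have "{\<omega> \<in> space M. \<forall>y\<in>F. K y \<omega> = c y} \<in> sets M"
        using K_meas F_fin by (intro sets.sets_Collect_finite_All) (auto simp: F_def)
      moreover have "{\<omega> \<in> space M. Z \<omega> \<and> (\<forall>y\<in>F. K y \<omega> = c y)} = {\<omega> \<in> space M. Z \<omega>} \<inter> {\<omega> \<in> space M. \<forall>y\<in>F. K y \<omega> = c y}"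
        by auto
      ultimately show ?thesis by auto
    qed
    have "prob_N M T J B X t m = measure M (\<Union>c\<in>compositions F ?U m. A c)"
      unfolding prob_N_def
    proof (rule finite_measure_eq_AE)
      show "AE \<omega> in M. \<omega> \<in> {\<omega> \<in> space M. \<forall>k\<in>?U. number_in_queue T J B X t k \<omega> = m k} \<longleftrightarrow> \<omega> \<in> (\<Union>c\<in>compositions F ?U m. A c)"
        using arrived_AE[of t] AE_space
      proof eventually_elim
        case (elim \<omega>)
        then have fin: "finite (arrived t \<omega>)" and sp: "\<omega> \<in> space M" by auto
        have "(\<forall>k\<in>?U. number_in_queue T J B X t k \<omega> = m k) \<longleftrightarrow> (\<forall>k\<in>?U. (\<Sum>i\<in>arrived t \<omega>. batch_occupancy t i \<omega> k) = m k)"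
          using number_in_queue_eq_sum[OF t fin] by simp
        also have "\<dots> \<longleftrightarrow> Z \<omega> \<and> (\<lambda>y\<in>F. K y \<omega>) \<in> compositions F ?U m"
          unfolding Z_def K_def box_def
          by (rule sum_vectors_iff_multiplicities[OF fin _ occupancy_PiE]) (auto simp: F_def box_def null_def m)
        finally show ?case using sp by (auto simp: A_def)
      qed
      show "{\<omega> \<in> space M. \<forall>k\<in>?U. number_in_queue T J B X t k \<omega> = m k} \<in> sets M"
        using number_in_queue_measurable[OF t] by (intro sets.sets_Collect_finite_All) auto
      show "(\<Union>c\<in>compositions F ?U m. A c) \<in> sets M"
        using A_meas comp_fin by (intro sets.finite_UN) auto
    qed
    also have "\<dots> = (\<Sum>c\<in>compositions F ?U m. measure M (A c))"
      using A_meas comp_fin by (intro finite_measure_finite_Union) (auto simp: disjoint_family_on_def A_def)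
    also have "\<dots> = (\<Sum>c\<in>compositions F ?U m. C * poisson_weight \<eta> F c)"
      unfolding A_def by (intro sum.cong refl weights) (auto simp: compositions_def)
    finally show ?thesis by (simp add: sum_distrib_left)
  qed
  have "real (n v) * prob_N M T J B X t n = C * (real (n v) * (\<Sum>c\<in>compositions F ?U n. poisson_weight \<eta> F c))"
    using law[of n] by simp
  also have "\<dots> = C * (\<Sum>y\<in>F. real (y v) * \<eta> y * (\<Sum>c\<in>compositions F ?U (\<lambda>k. n k - y k). poisson_weight \<eta> F c))"
    by (subst compositions_recursion[OF F_fin finite_atLeastAtMost nz _ v]) (auto simp: F_def box_def PiE_iff)
  also have "\<dots> = (\<Sum>y\<in>F. real (y v) * prob_N M T J B X t (\<lambda>k. n k - y k) * \<eta> y)"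
    unfolding sum_distrib_left by (intro sum.cong refl) (simp add: law sum_distrib_left mult_ac)
  also have "\<dots> = (\<Sum>y\<in>box. real (y v) * prob_N M T J B X t (\<lambda>k. n k - y k) * \<eta> y)"
    using F_fin null_F v by (simp add: box_eq null_def)
  finally show ?thesis unfolding box_def \<eta>_def .
qed

end

section \<open>The negative binomial network\<close>

theorem corollary5p1p3:
  fixes M :: "'a measure"
    and lam :: "real \<Rightarrow> real"
    and T :: "nat \<Rightarrow> 'a \<Rightarrow> ereal"
    and J v :: nat
    and D :: "(nat \<Rightarrow> nat) measure"
    and S :: "nat pmf"
    and p :: "nat \<Rightarrow> real"
    and B :: "nat \<Rightarrow> nat \<Rightarrow> 'a \<Rightarrow> nat"
    and X :: "nat \<Rightarrow> nat \<Rightarrow> nat \<Rightarrow> real \<Rightarrow> 'a \<Rightarrow> nat"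
    and q :: "nat \<Rightarrow> nat \<Rightarrow> real \<Rightarrow> real"
    and \<nu> r t :: real
    and n :: "nat \<Rightarrow> nat"
  assumes "batch_arrival_network M lam T J D S p B X q"
    and "0 < \<nu>" and "0 < r"
    and "\<And>z. z \<in> {0..1} \<Longrightarrow> pgf S z = 1 / (1 + \<nu> * (1 - z)) powr r"
    and "0 \<le> t"
    and "v \<in> {2..J}"
    and "1 \<le> n v"
  shows "prob_N M T J B X t (zero_above v n) =
    (\<Sum>i \<in> (\<Pi>\<^sub>E k\<in>{1..v}. if k = v then {1..n k} else {0..n k}).
       real (i v) / real (n v) * prob_N M T J B X t (zero_above v (\<lambda>k. n k - i k)) *
       (LINT \<tau>:{0..t}|lborel.
          lam \<tau> *
          (Gamma (r + real (\<Sum>k=1..v. i k)) / (Gamma r * (\<Prod>k=1..v. fact (i k)))) *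
          (\<nu> ^ (\<Sum>k=1..v. i k) /
             (1 + \<nu> * (\<Sum>k=1..J. queue_prob J p q k (t - \<tau>))) powr (r + real (\<Sum>k=1..v. i k))) *
          (\<Prod>k=1..v. queue_prob J p q k (t - \<tau>) ^ i k)))"
proof -
  interpret batch_arrival_network M lam T J D S p B X q by fact
  define Q where "Q = queue_prob J p q"
  define f where "f s y =
     Gamma (r + real (\<Sum>k=1..J. y k)) / (Gamma r * (\<Prod>k=1..J. fact (y k))) *
     (\<nu> ^ (\<Sum>k=1..J. y k) / (1 + \<nu> * (\<Sum>k=1..J. Q k s)) powr (r + real (\<Sum>k=1..J. y k))) *
     (\<Prod>k=1..J. Q k s ^ y k)" for s and y :: "nat \<Rightarrow> nat"
  define N where "N = zero_above v n"
  define box where "box = (\<Pi>\<^sub>E k\<in>{1..J}. {0..N k})"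
  define I where "I = (\<Pi>\<^sub>E k\<in>{1..v}. if k = v then {1..n k} else {0..n k})"
  define pad where "pad i = (\<lambda>k\<in>{1..J}. if k \<le> v then i k else 0)" for i :: "nat \<Rightarrow> nat"
  have v: "1 \<le> v" "v \<le> J" using assms(6) by auto
  have Nv: "N v = n v" by (simp add: N_def zero_above_def)
  have pad_sum: "(\<Sum>k=1..J. pad i k) = (\<Sum>k=1..v. i k)" for i
    using v by (intro sum.mono_neutral_cong_right) (auto simp: pad_def)
  have pad_prod: "(\<Prod>k=1..J. g k (pad i k)) = (\<Prod>k=1..v. g k (i k))" if "\<And>k. g k 0 = 1" for i and g :: "nat \<Rightarrow> nat \<Rightarrow> real"
    using v that by (intro prod.mono_neutral_cong_right) (auto simp: pad_def)
  have box_fin: "finite box" unfolding box_def by (intro finite_PiE) auto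
  let ?term = "\<lambda>y. real (y v) * prob_N M T J B X t (\<lambda>k. N k - y k) * (LINT \<tau>:{0..t}|lborel. lam \<tau> * f (t - \<tau>) y)"
  let ?goal = "\<lambda>i. prob_N M T J B X t (zero_above v (\<lambda>k. n k - i k)) *
       (LINT \<tau>:{0..t}|lborel.
          lam \<tau> *
          (Gamma (r + real (\<Sum>k=1..v. i k)) / (Gamma r * (\<Prod>k=1..v. fact (i k)))) *
          (\<nu> ^ (\<Sum>k=1..v. i k) /
             (1 + \<nu> * (\<Sum>k=1..J. queue_prob J p q k (t - \<tau>))) powr (r + real (\<Sum>k=1..v. i k))) *
          (\<Prod>k=1..v. queue_prob J p q k (t - \<tau>) ^ i k))"
  \<comment> \<open>Entries above \<open>v\<close> are zero, so the vectors \<open>y \<le> N\<close> with \<open>y v \<ge> 1\<close> are the indices of the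
    claimed sum padded with zeros; terms with \<open>y v = 0\<close> vanish.\<close>
  have "real (N v) * prob_N M T J B X t N = (\<Sum>y\<in>box. ?term y)"
    unfolding box_def
  proof (rule prob_N_recursion[OF assms(5)])
    fix i s y assume "0 \<le> (s :: real)" "y \<in> (\<Pi>\<^sub>E k\<in>{1..J}. {0..N k})"
    then show "expectation (\<lambda>\<omega>. of_bool (occupancy i s \<omega> = y)) = f s y"
      unfolding f_def Q_def using assms(2-4) by (intro occupancy_negative_multinomial) (auto simp: PiE_iff)
  qed (use v in auto)
  also have "\<dots> = (\<Sum>y\<in>{y \<in> box. 1 \<le> y v}. ?term y)"
    using box_fin by (intro sum.mono_neutral_right) auto
  also have "\<dots> = (\<Sum>i\<in>I. real (i v) * ?goal i)"
  proof (rule sum.reindex_bij_witness[where i=pad and j="\<lambda>y. restrict y {1..v}"])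
    fix y assume y: "y \<in> {y \<in> box. 1 \<le> y v}"
    then have y_le: "y k \<le> N k" if "k \<in> {1..J}" for k
      using that unfolding box_def by (auto simp: PiE_iff)
    have y0: "y k = 0" if "k \<in> {1..J}" "\<not> k \<le> v" for k
      using y_le[OF that(1)] that(2) by (simp add: N_def zero_above_def)
    have yN: "y k \<le> n k" if "k \<in> {1..J}" "k \<le> v" for k
      using y_le[OF that(1)] that(2) by (simp add: N_def zero_above_def)
    show pad_y: "pad (restrict y {1..v}) = y"
      using y y0 by (auto simp: pad_def fun_eq_iff box_def PiE_iff extensional_def)
    show "restrict y {1..v} \<in> I"
      using y yN v by (auto simp: I_def)
    let ?i = "restrict y {1..v}"
    have "prob_N M T J B X t (\<lambda>k. N k - y k) = prob_N M T J B X t (zero_above v (\<lambda>k. n k - ?i k))"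
      unfolding prob_N_def by (intro arg_cong[where f="measure M"] Collect_cong conj_cong ball_cong refl)
        (auto simp: N_def zero_above_def y0)
    moreover have "lam \<tau> * f (t - \<tau>) y = lam \<tau> *
          (Gamma (r + real (\<Sum>k=1..v. ?i k)) / (Gamma r * (\<Prod>k=1..v. fact (?i k)))) *
          (\<nu> ^ (\<Sum>k=1..v. ?i k) /
             (1 + \<nu> * (\<Sum>k=1..J. queue_prob J p q k (t - \<tau>))) powr (r + real (\<Sum>k=1..v. ?i k))) *
          (\<Prod>k=1..v. queue_prob J p q k (t - \<tau>) ^ ?i k)" for \<tau>
    proof -
      have "(\<Sum>k=1..J. y k) = (\<Sum>k=1..v. ?i k)"
        using pad_sum[of ?i] unfolding pad_y .
      moreover have "(\<Prod>k=1..J. fact (y k)) = (\<Prod>k=1..v. fact (?i k) :: real)"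
        using pad_prod[of "\<lambda>k x. fact x" ?i] unfolding pad_y by simp
      moreover have "(\<Prod>k=1..J. Q k (t - \<tau>) ^ y k) = (\<Prod>k=1..v. Q k (t - \<tau>) ^ ?i k)"
        using pad_prod[of "\<lambda>k x. Q k (t - \<tau>) ^ x" ?i] unfolding pad_y by simp
      ultimately show ?thesis unfolding f_def Q_def by (simp only: mult.assoc)
    qed
    ultimately show "real (?i v) * ?goal ?i = ?term y"
      using v by simp
  next
    fix i assume i: "i \<in> I"
    show "restrict (pad i) {1..v} = i"
      using i v by (auto simp: pad_def fun_eq_iff I_def PiE_iff extensional_def)
    have "pad i \<in> box"
      using i unfolding box_def I_def
      by (auto simp: pad_def N_def zero_above_def PiE_iff split: if_splits)
    moreover have "1 \<le> pad i v" using PiE_mem[OF i[unfolded I_def], of v] v by (simp add: pad_def)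
    ultimately show "pad i \<in> {y \<in> box. 1 \<le> y v}" by simp
  qed
  finally have "real (n v) * prob_N M T J B X t N = (\<Sum>i\<in>I. real (i v) * ?goal i)" by (simp only: Nv)
  then have "prob_N M T J B X t N = (\<Sum>i\<in>I. real (i v) * ?goal i) / real (n v)"
    using assms(7) by (simp add: field_simps)
  also have "\<dots> = (\<Sum>i\<in>I. real (i v) / real (n v) * ?goal i)"
    by (simp add: sum_divide_distrib)
  finally show ?thesis unfolding N_def I_def by (simp only: mult.assoc)
qed

end
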